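(* Consider the semidefinite problem of minimizing $f(X)$ subject to $\mathcal{A}(X)=b$, $X\succeq0$ with unique solution $X_\star$ of rank $r_\star$, and assume either setting (E) (exact rank, $r=r_\star$) or setting (O) (linear objective, $r\ge r_\star$) of the context. For sufficiently large $\lambda$ (as in these settings), let $\varphi(R)=f(RR^\top)+\lambda\|\mathcal{A}(RR^\top)-b\|_2$ on $\mathbb{R}^{n\times r}$, $S=\{R\in\mathbb{R}^{n\times r}:RR^\top=X_\star\}$, $\varphi_\star=f(X_\star)$, and let $\alpha_\varphi>0$ be the local quadratic growth constant of $\varphi$, i.e. $\varphi(R)\ge\varphi_\star+\frac{\alpha_\varphi}{2}\mathrm{dist}(R,S)^2$ for all $R$ near $S$. Then, initializing at $R^0$ sufficiently close to $S$, the prox-linear algorithm with stepsize $t=\frac{1}{2(L_f+\lambda\|\mathcal{A}\|_{\mathrm{op}})}$ converges linearly: for all $k\ge0$, $$\varphi(R^{k+1})-\varphi_\star\le q\,(\varphi(R^k)-\varphi_\star),\qquad q=1-\frac{1}{209+5000(L_f+\lambda\|\mathcal{A}\|_{\mathrm{op}})/\alpha_\varphi}.$$ If moreover one initializes in a sufficiently small neighborhood of $S$ and takes $\lambda=\Lambda$, the lowest possible choice defined in the context, then the linear rate is $q=1-M^{-1}$ with $$M=O\left(\frac{L_f+\|\mathcal{A}\|_{\mathrm{op}}\,\|y_\star\|_2\,\sigma_{\max}(M_{R_\star})/\gamma}{\alpha_\varphi}\right).$$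
   Context: $\mathbb{S}^n$ is the space of symmetric $n\times n$ matrices with Frobenius inner product. $\mathcal{A}:\mathbb{S}^n\to\mathbb{R}^k$, $[\mathcal{A}(X)]_i=\langle A_i,X\rangle$, $A_i\in\mathbb{S}^n$, $b\in\mathbb{R}^k$; $\|\mathcal{A}\|_{\mathrm{op}}$ is its operator norm from Frobenius norm to Euclidean norm. $f:\mathbb{S}^n\to\mathbb{R}$ is convex; $L_f$ is a Lipschitz constant of $f$ near $X_\star$ (Frobenius norm). $\mathrm{dist}(R,S)=\min_{R'\in S}\|R-R'\|_F$. $R_\star$ denotes an element of $S$, and $M_R=[\mathrm{vec}(A_1R)\ \cdots\ \mathrm{vec}(A_kR)]\in\mathbb{R}^{nr\times k}$; $\sigma_{\max}(M_{R_\star})$ does not depend on the choice of $R_\star\in S$. $O(\cdot)$ hides numerical constants. Prox-linear algorithm with stepsize $t$: with $h(X)=f(X)+\lambda\|\mathcal{A}(X)-b\|_2$, $R^{k+1}=\arg\min_{R\in\mathbb{R}^{n\times r}}\big\{h\big(R^kR^{k\top}+R^k(R-R^k)^\top+(R-R^k)R^{k\top}\big)+\frac1{2t}\|R-R^k\|_F^2\big\}$. Rank-$r$ constraint qualification: $\mathcal{M}_r=\{R\in\mathbb{R}^{n\times r}:\mathcal{A}(RR^\top)=b\}$ is a smooth manifold and there is $\gamma>0$ with $\sigma_{\min}(M_R)\ge\gamma$ (the $k$-th largest singular value) for all $R$ in a neighborhood of $S$. Dual optimum: $y_\star\in\mathbb{R}^k$, $Z_\star\succeq0$ with $\nabla f(X_\star)+\sum_i(y_\star)_iA_i-Z_\star=0$,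 $\langle Z_\star,X_\star\rangle=0$. Setting (E): $r=r_\star$; $f\in C^2$ with $\|\nabla^2f(X)\|_{\mathrm{op}}\le\beta_f$, $\|\nabla^2f(X_1)-\nabla^2f(X_2)\|_{\mathrm{op}}\le\rho_f\|X_1-X_2\|_F$ for all $X,X_1,X_2\succeq0$; a dual optimum $(y_\star,Z_\star)$ exists; there are $\alpha_f>0$, $\varepsilon>0$ with $f(X)\ge f(X_\star)+\frac{\alpha_f}{2}\|X-X_\star\|_F^2$ for all $X\succeq0$ with $\mathcal{A}(X)=b$, $\mathrm{rank}(X)\le r_\star$, $\|X-X_\star\|_F\le\varepsilon$; and the rank-$r_\star$ constraint qualification holds. Setting (O): $f(X)=\langle C,X\rangle$ with $C\in\mathbb{S}^n$; $r\ge r_\star$; the rank-$r$ constraint qualification holds; there is a dual optimum $(y_\star,Z_\star)$ such that the $(r_\star+1)$-th smallest singular value of $Z_\star$ is at least some $\lambda_{Z_\star}>0$; and there is $\gamma_Q>0$ with $\sum_{i=1}^k\langle Q_1^\top A_iQ_1,W\rangle^2\ge\gamma_Q\|W\|_F^2$ for all $W\in\mathbb{S}^{r_\star}$, where $X_\star=Q_1\Sigma_xQ_1^\top$ is the eigenvalue decomposition with $Q_1\in\mathbb{R}^{n\times r_\star}$ having orthonormal columns and $\Sigma_x$ diagonal and positive definite. Threshold: with $\varphi_f(R)=f(RR^\top)$, $\Lambda=\max\{2L_{\varphi_f}/\gamma,\ 2\sup_{R\in S}\|z(R)\|_2\}$, where $L_{\varphi_f}$ is a Lipschitz constant of $\varphi_f$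 in the (small) neighborhood of $S$ considered and $z(R)=\arg\min_{z\in\mathbb{R}^k}\|\nabla\varphi_f(R)+2\sum_{i=1}^kz_iA_iR\|_F$.
   Formalization: The bound M = O(κ), with κ the displayed ratio, is read as M ≤ 209 + 20000κ with M ≥ 1: a pure O(κ) fails when α_φ is very large (e.g. f(X)=X, constraint X=1, n=r=k=1), where it would force q<0. *)

theory Defs
  imports "HOL-Analysis.Analysis" "HOL-Library.Multiset"
begin

text \<open>The norm and inner product of the library on \<^typ>\<open>real^'n^'m\<close> are the Frobenius ones.
  The space of symmetric matrices is a subspace of \<^typ>\<open>real^'n^'n\<close>; functions on it are
  represented by functions on \<^typ>\<open>real^'n^'n\<close> whose values elsewhere are never used.\<close>

definition sym_mats :: "(real^'n^'n) set" where
  "sym_mats = {X. transpose X = X}"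

definition psd :: "real^'n^'n \<Rightarrow> bool" where
  "psd X \<longleftrightarrow> X \<in> sym_mats \<and> (\<forall>v. 0 \<le> v \<bullet> (X *v v))"

definition onorm_on :: "'a::real_normed_vector set \<Rightarrow> ('a \<Rightarrow> 'b::real_normed_vector) \<Rightarrow> real" where
  "onorm_on V g = (SUP x\<in>V. norm (g x) / norm x)"

definition meas_op :: "('k \<Rightarrow> real^'n^'n) \<Rightarrow> real^'n^'n \<Rightarrow> real^'k" where
  "meas_op A X = (\<chi> i. A i \<bullet> X)"


subsection \<open>Calculus on symmetric matrices\<close>

definition has_sym_gradient :: "(real^'n^'n \<Rightarrow> real) \<Rightarrow> real^'n^'n \<Rightarrow> real^'n^'n \<Rightarrow> bool" where
  "has_sym_gradient f G X \<longleftrightarrow>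
     G \<in> sym_mats \<and> (f has_derivative (\<lambda>H. G \<bullet> H)) (at X within sym_mats)"

text \<open>\<open>G\<close> is the gradient of \<open>f\<close>, \<open>H X\<close> is the Hessian at \<open>X\<close> as a linear operator on the
  symmetric matrices (only its restriction to them is determined).\<close>

definition C2_with :: "(real^'n^'n \<Rightarrow> real) \<Rightarrow> (real^'n^'n \<Rightarrow> real^'n^'n) \<Rightarrow>
    (real^'n^'n \<Rightarrow> real^'n^'n \<Rightarrow> real^'n^'n) \<Rightarrow> bool" where
  "C2_with f G H \<longleftrightarrow>
     (\<forall>X\<in>sym_mats. has_sym_gradient f (G X) X) \<and>
     (\<forall>X\<in>sym_mats. (G has_derivative H X) (at X within sym_mats)) \<and>
     (\<forall>X\<in>sym_mats. ((\<lambda>Y. onorm_on sym_mats (\<lambda>D. H Y D - H X D)) \<longlongrightarrow> 0) (at X within sym_mats))"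

definition grad :: "('a::real_inner \<Rightarrow> real) \<Rightarrow> 'a \<Rightarrow> 'a" where
  "grad g x = (THE D. GDERIV g x :> D)"

definition best_lipschitz :: "'a::metric_space set \<Rightarrow> ('a \<Rightarrow> real) \<Rightarrow> real" where
  "best_lipschitz N g = Inf {L. L-lipschitz_on N g}"


subsection \<open>Singular values\<close>

text \<open>The singular values of an \<open>m \<times> c\<close> matrix \<open>M\<close> are the \<open>c\<close> square roots of the eigenvalues of
  \<open>M\<^sup>T M\<close> (zeros included), listed in increasing order and with multiplicity.\<close>

definition singular_values :: "real^'c^'m \<Rightarrow> real list" where
  "singular_values M =
     (let E = (\<lambda>s. {v. (transpose M ** M) *v v = s\<^sup>2 *\<^sub>R v})
      in sorted_list_of_multiset (\<Sum>s | 0 \<le> s \<and> E s \<noteq> {0}. replicate_mset (dim (E s)) s))"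

definition nth_smallest_sv :: "nat \<Rightarrow> real^'c^'m \<Rightarrow> real" where
  "nth_smallest_sv j M = singular_values M ! (j - 1)"

definition nth_largest_sv :: "nat \<Rightarrow> real^'c^'m \<Rightarrow> real" where
  "nth_largest_sv j M = rev (singular_values M) ! (j - 1)"


subsection \<open>Embedded smooth submanifolds of a Euclidean space\<close>

fun Ck_on :: "nat \<Rightarrow> 'a::euclidean_space set \<Rightarrow> ('a \<Rightarrow> 'b::euclidean_space) \<Rightarrow> bool" where
  "Ck_on 0 U g \<longleftrightarrow> continuous_on U g"
| "Ck_on (Suc m) U g \<longleftrightarrow> (\<forall>x\<in>U. g differentiable (at x)) \<and>
     (\<forall>v. Ck_on m U (\<lambda>x. frechet_derivative g (at x) v))"

definition smooth_on :: "'a::euclidean_space set \<Rightarrow> ('a \<Rightarrow> 'b::euclidean_space) \<Rightarrow> bool" where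
  "smooth_on U g \<longleftrightarrow> (\<forall>m. Ck_on m U g)"

definition smooth_submanifold :: "'a::euclidean_space set \<Rightarrow> bool" where
  "smooth_submanifold M \<longleftrightarrow> (\<exists>d. \<forall>p\<in>M. \<exists>U V W (\<phi> :: 'a \<Rightarrow> 'a) \<psi>.
     open U \<and> open V \<and> p \<in> U \<and> subspace W \<and> dim W = d \<and>
     homeomorphism U V \<phi> \<psi> \<and> smooth_on U \<phi> \<and> smooth_on V \<psi> \<and> \<phi> ` (U \<inter> M) = V \<inter> W)"


subsection \<open>The semidefinite problem and its factorization\<close>

definition sdp_feasible :: "('k::finite \<Rightarrow> real^'n^'n) \<Rightarrow> real^'k \<Rightarrow> real^'n^'n \<Rightarrow> bool" where
  "sdp_feasible A b X \<longleftrightarrow> meas_op A X = b \<and> psd X"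

definition dual_optimum :: "(real^'n^'n \<Rightarrow> real) \<Rightarrow> ('k::finite \<Rightarrow> real^'n^'n) \<Rightarrow> real^'n^'n \<Rightarrow>
    real^'k \<Rightarrow> real^'n^'n \<Rightarrow> bool" where
  "dual_optimum f A Xs y Z \<longleftrightarrow> psd Z \<and> Z \<bullet> Xs = 0 \<and>
     (\<exists>G. has_sym_gradient f G Xs \<and> G + (\<Sum>i\<in>UNIV. y $ i *\<^sub>R A i) - Z = 0)"

definition factors :: "real^'n^'n \<Rightarrow> (real^'r^'n) set" where
  "factors X = {R. R ** transpose R = X}"

definition nbhd :: "'a::metric_space set \<Rightarrow> real \<Rightarrow> 'a set" where
  "nbhd S \<delta> = {R. infdist R S < \<delta>}"

definition M_mat :: "('k \<Rightarrow> real^'n^'n) \<Rightarrow> real^'r^'n \<Rightarrow> real^'k^('n \<times> 'r)" where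
  "M_mat A R = (\<chi> p l. (A l ** R) $ fst p $ snd p)"

definition constraint_qualification :: "('k::finite \<Rightarrow> real^'n^'n) \<Rightarrow> real^'k \<Rightarrow>
    (real^'r^'n) set \<Rightarrow> real \<Rightarrow> bool" where
  "constraint_qualification A b S \<gamma> \<longleftrightarrow>
     smooth_submanifold {R :: real^'r^'n. meas_op A (R ** transpose R) = b} \<and>
     \<gamma> > 0 \<and> (\<exists>\<delta>>0. \<forall>R\<in>nbhd S \<delta>. nth_largest_sv CARD('k) (M_mat A R) \<ge> \<gamma>)"

definition phi_f :: "(real^'n^'n \<Rightarrow> real) \<Rightarrow> real^'r^'n \<Rightarrow> real" where
  "phi_f f R = f (R ** transpose R)"

definition h_fun :: "(real^'n^'n \<Rightarrow> real) \<Rightarrow> ('k::finite \<Rightarrow> real^'n^'n) \<Rightarrow> real^'k \<Rightarrow> real \<Rightarrow>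
    real^'n^'n \<Rightarrow> real" where
  "h_fun f A b lam X = f X + lam * norm (meas_op A X - b)"

definition phi :: "(real^'n^'n \<Rightarrow> real) \<Rightarrow> ('k::finite \<Rightarrow> real^'n^'n) \<Rightarrow> real^'k \<Rightarrow> real \<Rightarrow>
    real^'r^'n \<Rightarrow> real" where
  "phi f A b lam R = h_fun f A b lam (R ** transpose R)"

definition quadratic_growth :: "('a::metric_space \<Rightarrow> real) \<Rightarrow> real \<Rightarrow> 'a set \<Rightarrow> real \<Rightarrow> bool" where
  "quadratic_growth g gs S \<alpha> \<longleftrightarrow>
     (\<exists>\<delta>>0. \<forall>R\<in>nbhd S \<delta>. g R \<ge> gs + \<alpha> / 2 * (infdist R S)\<^sup>2)"


subsection \<open>The penalty threshold\<close>

definition multiplier :: "(real^'n^'n \<Rightarrow> real) \<Rightarrow> ('k::finite \<Rightarrow> real^'n^'n) \<Rightarrow> real^'r^'n \<Rightarrow> real^'k" where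
  "multiplier f A R =
     arg_min (\<lambda>z. norm (grad (phi_f f) R + 2 *\<^sub>R (\<Sum>i\<in>UNIV. z $ i *\<^sub>R (A i ** R)))) (\<lambda>_. True)"

definition threshold :: "(real^'n^'n \<Rightarrow> real) \<Rightarrow> ('k::finite \<Rightarrow> real^'n^'n) \<Rightarrow> (real^'r^'n) set \<Rightarrow>
    real \<Rightarrow> real \<Rightarrow> real" where
  "threshold f A S \<gamma> L = max (2 * L / \<gamma>) (2 * (SUP R\<in>S. norm (multiplier f A R)))"


subsection \<open>The prox-linear algorithm\<close>

definition prox_linear_step :: "(real^'n^'n \<Rightarrow> real) \<Rightarrow> real \<Rightarrow> real^'r^'n \<Rightarrow> real^'r^'n" where
  "prox_linear_step h t R =
     arg_min (\<lambda>R'. h (R ** transpose R + R ** transpose (R' - R) + (R' - R) ** transpose R)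
                   + 1 / (2 * t) * (norm (R' - R))\<^sup>2) (\<lambda>_. True)"

definition prox_linear :: "(real^'n^'n \<Rightarrow> real) \<Rightarrow> real \<Rightarrow> real^'r^'n \<Rightarrow> nat \<Rightarrow> real^'r^'n" where
  "prox_linear h t R0 j = (prox_linear_step h t ^^ j) R0"

text \<open>From every starting point near \<open>S\<close>, prox-linear with stepsize \<open>1 / (2 * (L + lam * \<parallel>A\<parallel>))\<close>
  contracts the objective gap by the factor \<open>q\<close> in every iteration.\<close>

definition prox_linear_converges :: "(real^'n^'n \<Rightarrow> real) \<Rightarrow> ('k::finite \<Rightarrow> real^'n^'n) \<Rightarrow> real^'k \<Rightarrow>
    real \<Rightarrow> real \<Rightarrow> real \<Rightarrow> (real^'r^'n) set \<Rightarrow> real \<Rightarrow> bool" where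
  "prox_linear_converges f A b lam L gs S q \<longleftrightarrow>
     (let t = 1 / (2 * (L + lam * onorm_on sym_mats (meas_op A)));
          R = prox_linear (h_fun f A b lam) t
      in \<exists>\<delta>>0. \<forall>R0\<in>nbhd S \<delta>. \<forall>j.
           phi f A b lam (R R0 (Suc j)) - gs \<le> q * (phi f A b lam (R R0 j) - gs))"


subsection \<open>The two settings\<close>

definition setting_E :: "(real^'n^'n \<Rightarrow> real) \<Rightarrow> ('k::finite \<Rightarrow> real^'n^'n) \<Rightarrow> real^'k \<Rightarrow>
    real^'n^'n \<Rightarrow> (real^'r^'n) set \<Rightarrow> real \<Rightarrow> real^'k \<Rightarrow> real^'n^'n \<Rightarrow> bool" where
  "setting_E f A b Xs S \<gamma> y Z \<longleftrightarrow>
     CARD('r) = rank Xs \<and>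
     (\<exists>G H \<beta> \<rho>. C2_with f G H \<and>
        (\<forall>X. psd X \<longrightarrow> onorm_on sym_mats (H X) \<le> \<beta>) \<and>
        (\<forall>X1 X2. psd X1 \<longrightarrow> psd X2 \<longrightarrow>
           onorm_on sym_mats (\<lambda>D. H X1 D - H X2 D) \<le> \<rho> * norm (X1 - X2))) \<and>
     dual_optimum f A Xs y Z \<and>
     (\<exists>\<alpha>>0. \<exists>\<epsilon>>0. \<forall>X. psd X \<and> meas_op A X = b \<and> rank X \<le> rank Xs \<and> norm (X - Xs) \<le> \<epsilon> \<longrightarrow>
        f X \<ge> f Xs + \<alpha> / 2 * (norm (X - Xs))\<^sup>2) \<and>
     constraint_qualification A b S \<gamma>"

text \<open>The index type \<open>'q\<close> has \<open>rank Xs\<close> elements, and \<open>Q1\<close> collects the eigenvectors of \<open>Xs\<close> for the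
  nonzero eigenvalues.\<close>

definition setting_O :: "(real^'n^'n \<Rightarrow> real) \<Rightarrow> ('k::finite \<Rightarrow> real^'n^'n) \<Rightarrow> real^'k \<Rightarrow>
    real^'n^'n \<Rightarrow> (real^'r^'n) set \<Rightarrow> real \<Rightarrow> real^'k \<Rightarrow> real^'n^'n \<Rightarrow> real^'q^'n \<Rightarrow> bool" where
  "setting_O f A b Xs S \<gamma> y Z Q1 \<longleftrightarrow>
     (\<exists>C\<in>sym_mats. \<forall>X\<in>sym_mats. f X = C \<bullet> X) \<and>
     rank Xs \<le> CARD('r) \<and>
     constraint_qualification A b S \<gamma> \<and>
     dual_optimum f A Xs y Z \<and>
     rank Xs < CARD('n) \<and> (\<exists>l>0. nth_smallest_sv (rank Xs + 1) Z \<ge> l) \<and>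
     CARD('q) = rank Xs \<and> transpose Q1 ** Q1 = mat 1 \<and>
     (\<exists>\<sigma> :: 'q \<Rightarrow> real. (\<forall>i. \<sigma> i > 0) \<and>
        Xs = Q1 ** (\<chi> i j. if i = j then \<sigma> i else 0) ** transpose Q1) \<and>
     (\<exists>\<gamma>Q>0. \<forall>W\<in>sym_mats.
        (\<Sum>i\<in>UNIV. ((transpose Q1 ** A i ** Q1) \<bullet> W)\<^sup>2) \<ge> \<gamma>Q * (norm W)\<^sup>2)"

end

theory Submission
  imports Defs
begin

text \<open>
  Write \<open>\<eta> = L\<^sub>f + \<lambda> \<parallel>\<A>\<parallel>\<close> and \<open>h X = f X + \<lambda> \<parallel>\<A> X - b\<parallel>\<close>. Near \<open>Xs\<close> the function \<open>h\<close> is convex and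
  \<open>\<eta>\<close>-Lipschitz, and \<open>R R\<^sup>T\<close> differs from its linearization by \<open>H H\<^sup>T\<close>, where \<open>H\<close> is the step. Hence
  the objective of the proximal subproblem (the model) with stepsize \<open>1 / (2 \<eta>)\<close> majorizes \<open>\<phi>\<close> near
  the current point \<open>R\<close>, and one iteration decreases the gap \<open>\<phi> R - \<phi>\<^sub>*\<close> at least as much as any
  trial point decreases the model.

  The obvious trial direction leads from \<open>R\<close> to its nearest factor \<open>T\<close>. With \<open>D = R - T\<close> and
  \<open>d = \<parallel>D\<parallel>\<close>, the linearization then takes the value \<open>Xs - D D\<^sup>T\<close>, whose constraint violation can
  cost as much as a multiple of \<open>\<eta> d\<^sup>2\<close>. Quadratic growth only bounds \<open>d\<^sup>2\<close> by \<open>2 / \<alpha>\<close> times the gap, so this loss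
  is not affordable when \<open>\<alpha>\<close> is small compared with \<open>\<eta>\<close>. The constraint qualification repairs it: a
  correction \<open>W\<close> of norm \<open>O(d\<^sup>2)\<close> makes the linearization feasible, and at the corrected trial point
  \<open>f\<close> exceeds \<open>f Xs\<close> by \<open>o(d\<^sup>2)\<close> only. Indeed, on feasible perturbations \<open>E\<close> the gradient of \<open>f\<close> acts
  as \<open>Z\<close>; here \<open>E = R W\<^sup>T + W R\<^sup>T - D D\<^sup>T\<close>, the term with \<open>D\<close> contributes
  \<open>- \<langle>Z, D D\<^sup>T\<rangle> \<le> 0\<close>, and \<open>Z T = 0\<close> makes the terms with \<open>W\<close> of third order
  (\<open>second_order_feasible_direction\<close>). Moving a fraction \<open>s\<close> of the way to this point gains \<open>s\<close>
  times the gap and costs \<open>o(d\<^sup>2) + O(s\<^sup>2 \<eta> d\<^sup>2)\<close>; the choice \<open>s = \<alpha> / (\<alpha> + 16 \<eta>)\<close> yields a contraction factor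
  \<open>1 - 1 / O(1 + \<eta> / \<alpha>)\<close> (\<open>model_decrease\<close>, \<open>prox_linear_linear_rate\<close>). Strong convexity of the
  model keeps every proximal point close to \<open>R\<close> (\<open>prox_point_localized\<close>), and the decreasing gap
  together with quadratic growth keeps all iterates in the tube around \<open>S\<close> where this applies.

  For the lowest penalty parameter \<open>\<Lambda>\<close> it remains to bound \<open>\<Lambda>\<close> in terms of the dual optimum. On \<open>S\<close>
  the least-squares multiplier is \<open>y\<close>, and the gradient of \<open>R \<mapsto> f (R R\<^sup>T)\<close> is \<open>- 2 M\<^sub>R y\<close>, of norm at
  most \<open>2 \<parallel>y\<parallel> \<sigma>\<^sub>m\<^sub>a\<^sub>x\<close>. Hence on thin tubes the Lipschitz constant in \<open>\<Lambda>\<close> is at most slightly larger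
  (\<open>best_lipschitz_small_tube\<close>), and \<open>\<sigma>\<^sub>m\<^sub>a\<^sub>x \<ge> \<gamma>\<close> absorbs the term \<open>2 \<parallel>y\<parallel>\<close>.

  The singular values enter through the multiplicity list of eigenspaces of \<open>M\<^sup>T M\<close>; the spectral
  theorem (\<open>span_sv_spaces\<close>) shows that this list has full length, so that its first and last entries
  are the extreme stretching factors of \<open>M\<close>. That \<open>S\<close> is nonempty follows from a Cholesky factorization
  (\<open>psd_factorization\<close>).
\<close>

section \<open>The Frobenius inner product and matrix products\<close>

lemma inner_matrix_mul_left:
  fixes A :: "real^'n^'m" and B :: "real^'p^'n" and C :: "real^'p^'m"
  shows "(A ** B) \<bullet> C = A \<bullet> (C ** transpose B)"
proof -
  have "(\<Sum>j\<in>UNIV. (\<Sum>k\<in>UNIV. A $ i $ k * B $ k $ j) * C $ i $ j)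
      = (\<Sum>k\<in>UNIV. A $ i $ k * (\<Sum>j\<in>UNIV. C $ i $ j * B $ k $ j))" for i
    unfolding sum_distrib_left sum_distrib_right
    by (subst sum.swap) (simp add: mult_ac)
  then show ?thesis
    by (simp add: inner_vec_def matrix_matrix_mult_def transpose_def)
qed

lemma inner_transpose [simp]:
  fixes A B :: "real^'n^'m"
  shows "transpose A \<bullet> transpose B = A \<bullet> B"
  unfolding inner_vec_def transpose_def by (simp add: inner_vec_def) (rule sum.swap)

lemma norm_transpose [simp]: "norm (transpose (A :: real^'n^'m)) = norm A"
  by (simp add: norm_eq_sqrt_inner)

lemma inner_matrix_mul_right:
  fixes A :: "real^'n^'m" and B :: "real^'p^'n" and C :: "real^'p^'m"
  shows "(A ** B) \<bullet> C = B \<bullet> (transpose A ** C)"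
proof -
  have "(A ** B) \<bullet> C = (transpose B ** transpose A) \<bullet> transpose C"
    by (metis inner_transpose matrix_transpose_mul)
  also have "\<dots> = transpose B \<bullet> (transpose C ** A)"
    by (simp add: inner_matrix_mul_left)
  also have "\<dots> = B \<bullet> (transpose A ** C)"
    by (metis inner_transpose matrix_transpose_mul transpose_transpose)
  finally show ?thesis .
qed

lemma norm_matrix_mul_le:
  fixes A :: "real^'n^'m" and B :: "real^'p^'n"
  shows "norm (A ** B) \<le> norm A * norm B"
proof -
  have row: "norm ((A ** B) $ i) \<le> norm (A $ i) * norm B" for i
  proof -
    have "(A ** B) $ i = (\<Sum>k\<in>UNIV. A $ i $ k *\<^sub>R B $ k)"
      by (simp add: vec_eq_iff matrix_matrix_mult_def)
    then have "norm ((A ** B) $ i) \<le> (\<Sum>k\<in>UNIV. \<bar>A $ i $ k\<bar> * \<bar>norm (B $ k)\<bar>)"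
      by (simp add: sum_norm_le)
    also have "\<dots> \<le> norm (A $ i) * norm B"
      using L2_set_mult_ineq[of "\<lambda>k. \<bar>A $ i $ k\<bar>" "\<lambda>k. norm (B $ k)" UNIV]
      by (simp add: norm_vec_def[of B] norm_vec_def[of "A $ i"])
    finally show ?thesis .
  qed
  have "norm (A ** B) \<le> L2_set (\<lambda>i. norm (A $ i) * norm B) UNIV"
    unfolding norm_vec_def[of "A ** B"] by (rule L2_set_mono) (auto simp: row)
  also have "\<dots> = norm A * norm B"
    by (simp add: norm_vec_def[of A] L2_set_left_distrib)
  finally show ?thesis .
qed

lemma bounded_bilinear_matrix_mul:
  "bounded_bilinear ((**) :: real^'n^'m \<Rightarrow> real^'p^'n \<Rightarrow> real^'p^'m)"
proof
  show "\<exists>K. \<forall>(a :: real^'n^'m) (b :: real^'p^'n). norm (a ** b) \<le> norm a * norm b * K"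
    by (rule exI[of _ 1]) (simp add: norm_matrix_mul_le)
qed (simp_all add: vec_eq_iff matrix_matrix_mult_def algebra_simps sum.distrib sum_distrib_left)

interpretation matmul:
  bounded_bilinear "(**) :: real^'n^'m \<Rightarrow> real^'p^'n \<Rightarrow> real^'p^'m"
  by (rule bounded_bilinear_matrix_mul)

lemma transpose_add: "transpose (A + B) = transpose A + transpose (B :: real^'n^'m)"
  by (simp add: vec_eq_iff transpose_def)

lemma transpose_diff: "transpose (A - B) = transpose A - transpose (B :: real^'n^'m)"
  by (simp add: vec_eq_iff transpose_def)

lemma transpose_zero [simp]: "transpose (0 :: real^'n^'m) = 0"
  by (simp add: vec_eq_iff transpose_def)

lemma bounded_linear_transpose: "bounded_linear (transpose :: real^'n^'m \<Rightarrow> real^'m^'n)"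
proof
  show "\<exists>K. \<forall>x :: real^'n^'m. norm (transpose x) \<le> norm x * K"
    by (rule exI[of _ 1]) simp
qed (simp_all add: transpose_add transpose_scalar)

lemma subspace_sym_mats: "subspace (sym_mats :: (real^'n^'n) set)"
  unfolding subspace_def sym_mats_def by (simp add: transpose_add transpose_scalar)

lemmas sym_mats_add = subspace_add[OF subspace_sym_mats]
  and sym_mats_diff = subspace_diff[OF subspace_sym_mats]
  and sym_mats_scale = subspace_scale[OF subspace_sym_mats]
  and sym_mats_zero = subspace_0[OF subspace_sym_mats]

lemma convex_sym_mats: "convex (sym_mats :: (real^'n^'n) set)"
  by (rule subspace_imp_convex[OF subspace_sym_mats])

lemma gram_in_sym_mats: "R ** transpose R \<in> sym_mats" for R :: "real^'r^'n"
  by (simp add: sym_mats_def matrix_transpose_mul)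

text \<open>The derivative of \<open>R \<mapsto> R R\<^sup>T\<close> at \<open>R\<close> in direction \<open>H\<close>. The argument of \<open>h\<close> in a prox-linear step
  is the linearization \<open>R R\<^sup>T + sym_prod R (R' - R)\<close>.\<close>

definition sym_prod :: "real^'r^'n \<Rightarrow> real^'r^'n \<Rightarrow> real^'n^'n" where
  "sym_prod R H = R ** transpose H + H ** transpose R"

lemma sym_prod_in_sym_mats: "sym_prod R H \<in> sym_mats"
  by (simp add: sym_prod_def sym_mats_def matrix_transpose_mul transpose_add add.commute)

lemma sym_prod_add: "sym_prod R (H + K) = sym_prod R H + sym_prod R K"
  by (simp add: sym_prod_def transpose_add matmul.add_left matmul.add_right)

lemma sym_prod_scaleR: "sym_prod R (c *\<^sub>R H) = c *\<^sub>R sym_prod R H"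
  by (simp add: sym_prod_def transpose_scalar matmul.scaleR_left matmul.scaleR_right scaleR_add_right)

lemma sym_prod_diff: "sym_prod R (H - K) = sym_prod R H - sym_prod R K"
  by (simp add: sym_prod_def transpose_diff matmul.diff_left matmul.diff_right)

lemma sym_prod_zero [simp]: "sym_prod R 0 = 0"
  by (simp add: sym_prod_def matmul.zero_right matmul.zero_left)

lemma gram_add:
  "(R + H) ** transpose (R + H) = R ** transpose R + sym_prod R H + H ** transpose H"
  for R H :: "real^'r^'n"
  by (simp add: sym_prod_def transpose_add matmul.add_left matmul.add_right algebra_simps)

lemma norm_gram_le: "norm (H ** transpose H) \<le> (norm H)\<^sup>2" for H :: "real^'r^'n"
  using norm_matrix_mul_le[of H "transpose H"] by (simp add: power2_eq_square)

lemma norm_sym_prod_le: "norm (sym_prod R H) \<le> 2 * norm R * norm H"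
proof -
  have "norm (sym_prod R H) \<le> norm (R ** transpose H) + norm (H ** transpose R)"
    unfolding sym_prod_def by (rule norm_triangle_ineq)
  also have "\<dots> \<le> 2 * norm R * norm H"
    using norm_matrix_mul_le[of R "transpose H"] norm_matrix_mul_le[of H "transpose R"]
    by (simp add: mult.commute)
  finally show ?thesis .
qed

lemma inner_sym_prod:
  assumes "B \<in> sym_mats"
  shows "B \<bullet> sym_prod R H = 2 * ((B ** R) \<bullet> H)"
proof -
  have B: "transpose B = B"
    using assms by (simp add: sym_mats_def)
  have "B \<bullet> (R ** transpose H) = (B ** H) \<bullet> R"
    by (metis inner_commute inner_matrix_mul_left)
  also have "\<dots> = (B ** R) \<bullet> H"
    by (metis B inner_commute inner_matrix_mul_right)
  finally have 1: "B \<bullet> (R ** transpose H) = (B ** R) \<bullet> H" .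
  have 2: "B \<bullet> (H ** transpose R) = (B ** R) \<bullet> H"
    by (metis inner_matrix_mul_left)
  show ?thesis
    by (simp add: sym_prod_def inner_add_right 1 2)
qed

lemma gram_has_derivative:
  fixes R :: "real^'r^'n"
  shows "((\<lambda>R. R ** transpose R) has_derivative sym_prod R) (at R)"
proof -
  have "((\<lambda>R. R ** transpose R) has_derivative (\<lambda>h. R ** transpose h + h ** transpose R)) (at R)"
    by (intro matmul.FDERIV has_derivative_ident
        bounded_linear.has_derivative[OF bounded_linear_transpose])
  then show ?thesis
    by (simp add: sym_prod_def[abs_def])
qed

lemma continuous_on_gram: "continuous_on U (\<lambda>R :: real^'r^'n. R ** transpose R)"
  by (intro continuous_at_imp_continuous_on ballI
      has_derivative_continuous[OF gram_has_derivative])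

lemma norm_diff_gram_le:
  fixes R T :: "real^'r^'n"
  shows "norm (R ** transpose R - T ** transpose T) \<le> (norm R + norm T) * norm (R - T)"
proof -
  have "R ** transpose R - T ** transpose T
      = (R - T) ** transpose R + T ** transpose (R - T)"
    by (simp add: transpose_diff matmul.diff_left matmul.diff_right)
  also have "norm \<dots> \<le> norm ((R - T) ** transpose R) + norm (T ** transpose (R - T))"
    by (rule norm_triangle_ineq)
  also have "\<dots> \<le> norm (R - T) * norm R + norm T * norm (R - T)"
    using norm_matrix_mul_le[of "R - T" "transpose R"] norm_matrix_mul_le[of T "transpose (R - T)"]
    by (simp only: norm_transpose)
  finally show ?thesis
    by (simp add: algebra_simps)
qed

lemma norm_squared_gram: "(norm R)\<^sup>2 = mat 1 \<bullet> (R ** transpose R)" for R :: "real^'r^'n"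
proof -
  have "(norm R)\<^sup>2 = (mat 1 ** R) \<bullet> R"
    by (simp add: power2_norm_eq_inner)
  also have "\<dots> = mat 1 \<bullet> (R ** transpose R)"
    by (rule inner_matrix_mul_left)
  finally show ?thesis .
qed


section \<open>Positive semidefinite matrices\<close>

lemma inner_matrix_vector:
  fixes A :: "real^'n^'m"
  shows "(A *v x) \<bullet> y = x \<bullet> (transpose A *v y)"
  by (metis dot_lmul_matrix inner_commute transpose_matrix_vector)

lemma inner_gram_columns:
  fixes B :: "real^'n^'n" and R :: "real^'r^'n"
  shows "B \<bullet> (R ** transpose R) = (\<Sum>j\<in>UNIV. column j R \<bullet> (B *v column j R))"
proof -
  have col: "column j (B ** R) = B *v column j R" for j
    by (simp add: vec_eq_iff column_def matrix_matrix_mult_def matrix_vector_mult_def)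
  have "B \<bullet> (R ** transpose R) = R \<bullet> (B ** R)"
    by (metis inner_commute inner_matrix_mul_left)
  also have "\<dots> = (\<Sum>j\<in>UNIV. column j R \<bullet> column j (B ** R))"
    unfolding inner_vec_def column_def by simp (rule sum.swap)
  finally show ?thesis
    by (simp add: col)
qed

lemma psd_inner_gram_nonneg:
  assumes "psd B"
  shows "0 \<le> B \<bullet> (R ** transpose R)"
  unfolding inner_gram_columns using assms by (intro sum_nonneg) (simp add: psd_def)

text \<open>A nonnegative quadratic form obeys the Cauchy--Schwarz inequality, because its values along
  a line form a nonnegative quadratic polynomial.\<close>

lemma psd_Cauchy_Schwarz:
  assumes "psd B"
  shows "(w \<bullet> (B *v v))\<^sup>2 \<le> (w \<bullet> (B *v w)) * (v \<bullet> (B *v v))"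
proof -
  have B: "transpose B = B" and pos: "0 \<le> u \<bullet> (B *v u)" for u
    using assms by (auto simp: psd_def sym_mats_def)
  define a where "a = v \<bullet> (B *v v)"
  define c where "c = w \<bullet> (B *v v)"
  define e where "e = w \<bullet> (B *v w)"
  have sym: "v \<bullet> (B *v w) = c"
    unfolding c_def by (metis B inner_commute inner_matrix_vector)
  have quad: "0 \<le> e + 2 * t * c + t\<^sup>2 * a" for t
    using pos[of "w + t *\<^sub>R v"]
    by (simp add: matrix_vector_right_distrib matrix_vector_mult_scaleR inner_add_left
        inner_add_right sym a_def c_def[symmetric] e_def power2_eq_square algebra_simps)
  have "c\<^sup>2 \<le> e * a"
  proof (cases "a = 0")
    case True
    have "c = 0"
    proof (rule ccontr)
      assume "c \<noteq> 0"
      then show False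
        using quad[of "- (e + 1) / (2 * c)"] quad[of 0] True by (simp add: field_simps)
    qed
    then show ?thesis
      using True by simp
  next
    case False
    then have "a > 0"
      using pos[of v] by (simp add: a_def)
    then show ?thesis
      using quad[of "- c / a"] by (simp add: power2_eq_square field_simps)
  qed
  then show ?thesis
    by (simp add: a_def c_def e_def)
qed

lemma psd_kernel:
  assumes "psd B" "v \<bullet> (B *v v) = 0"
  shows "B *v v = 0"
  using psd_Cauchy_Schwarz[OF assms(1), of "B *v v" v] assms(2) by simp

lemma psd_annihilates_factor:
  fixes R :: "real^'r^'n"
  assumes "psd B" "B \<bullet> (R ** transpose R) = 0"
  shows "B ** R = 0"
proof -
  have "\<forall>j\<in>UNIV. column j R \<bullet> (B *v column j R) = 0"
    using assms unfolding inner_gram_columns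
    by (subst sum_nonneg_eq_0_iff[symmetric]) (auto simp: psd_def)
  then have "B *v column j R = 0" for j
    using psd_kernel[OF assms(1)] by blast
  then show ?thesis
    by (simp add: vec_eq_iff column_def matrix_matrix_mult_def matrix_vector_mult_def)
qed

lemma rank_eq_0_iff: "rank (B :: real^'n^'m) = 0 \<longleftrightarrow> B = 0"
proof
  assume "rank B = 0"
  then have "range ((*v) B) \<subseteq> {0}"
    by (simp add: rank_dim_range)
  then have "B *v x = 0 *v x" for x
    by auto
  then show "B = 0"
    by (metis matrix_eq)
qed (simp add: rank_dim_range image_def)

text \<open>Splitting off one outer product, as in a Cholesky factorization, keeps a matrix positive
  semidefinite and lowers its rank.\<close>

lemma psd_deflate:
  fixes B :: "real^'n^'n"
  assumes "psd B" "B \<noteq> 0"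
  obtains u where "psd (B - (\<chi> i j. u $ i * u $ j))" "rank (B - (\<chi> i j. u $ i * u $ j)) < rank B"
proof -
  have B: "transpose B = B" and pos: "\<And>u. 0 \<le> u \<bullet> (B *v u)"
    using assms by (auto simp: psd_def sym_mats_def)
  from assms(2) obtain v where v: "B *v v \<noteq> 0"
    by (metis matrix_eq matrix_vector_mult_0)
  define c where "c = v \<bullet> (B *v v)"
  have c: "c > 0"
    using pos[of v] psd_kernel[OF assms(1), of v] v by (auto simp: c_def less_le)
  define u where "u = (1 / sqrt c) *\<^sub>R (B *v v)"
  define K where "K = B - (\<chi> i j. u $ i * u $ j)"
  have outer: "(\<chi> i j. u $ i * u $ j) *v w = (u \<bullet> w) *\<^sub>R u" for w
    by (simp add: vec_eq_iff matrix_vector_mult_def inner_vec_def sum_distrib_left sum_distrib_right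
        mult_ac)
  have Kv: "K *v w = B *v w - (u \<bullet> w) *\<^sub>R u" for w
    by (simp add: K_def matrix_vector_mult_diff_rdistrib outer)
  have uw: "u \<bullet> w = (w \<bullet> (B *v v)) / sqrt c" for w
    by (simp add: u_def inner_commute)
  have "0 \<le> w \<bullet> (K *v w)" for w
  proof -
    have "w \<bullet> (K *v w) = w \<bullet> (B *v w) - (u \<bullet> w)\<^sup>2"
      by (simp add: Kv inner_diff_right power2_eq_square inner_commute)
    moreover have "(u \<bullet> w)\<^sup>2 \<le> w \<bullet> (B *v w)"
      using psd_Cauchy_Schwarz[OF assms(1), of w v] c
      by (simp add: uw power_divide c_def[symmetric] pos_divide_le_eq)
    ultimately show ?thesis
      by simp
  qed
  moreover have K_sym: "transpose K = K"
    using B by (simp add: K_def vec_eq_iff transpose_def mult.commute)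
  ultimately have psdK: "psd K"
    by (simp add: psd_def sym_mats_def)
  have K_v: "K *v v = 0"
    using c by (simp add: Kv uw c_def[symmetric]) (simp add: u_def)
  have orth: "v \<bullet> (K *v w) = 0" for w
  proof -
    have "v \<bullet> (K *v w) = (K *v v) \<bullet> w"
      by (metis K_sym inner_matrix_vector)
    then show ?thesis by (simp add: K_v)
  qed
  have K_in: "K *v w \<in> range ((*v) B)" for w
  proof -
    have "K *v w = B *v (w - ((u \<bullet> w) / sqrt c) *\<^sub>R v)"
      by (simp add: Kv u_def matrix_vector_mult_diff_distrib matrix_vector_mult_scaleR)
    then show ?thesis by blast
  qed
  have "B *v v \<notin> range ((*v) K)"
    using orth c by (auto simp: c_def)
  then have ne: "range ((*v) K) \<noteq> range ((*v) B)" by blast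
  have sub: "subspace (range ((*v) K))" "subspace (range ((*v) B))"
    by (auto intro: linear_subspace_image[OF matrix_vector_mul_linear subspace_UNIV])
  have "rank K < rank B"
    unfolding rank_dim_range using ne sub K_in
    by (intro dim_psubset) (auto simp: span_eq_iff[THEN iffD2])
  then show thesis
    using psdK that[of u] by (simp add: K_def)
qed

lemma psd_factorization:
  fixes B :: "real^'n^'n"
  assumes "psd B" "finite J" "rank B \<le> card J"
  shows "\<exists>u :: 'j \<Rightarrow> real^'n. B = (\<chi> i k. \<Sum>j\<in>J. u j $ i * u j $ k)"
  using assms(2,1,3)
proof (induction J arbitrary: B rule: finite_induct)
  case empty
  then show ?case
    by (simp add: rank_eq_0_iff vec_eq_iff)
next
  case (insert j J)
  show ?case
  proof (cases "B = 0")
    case True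
    then show ?thesis
      by (intro exI[of _ "\<lambda>_. 0"]) (simp add: vec_eq_iff)
  next
    case False
    from psd_deflate[OF insert.prems(1) this] obtain w where
      w: "psd (B - (\<chi> i j. w $ i * w $ j))" "rank (B - (\<chi> i j. w $ i * w $ j)) < rank B" .
    then obtain u :: "'j \<Rightarrow> real^'n"
      where u: "B - (\<chi> i j. w $ i * w $ j) = (\<chi> i k. \<Sum>j\<in>J. u j $ i * u j $ k)"
      using insert.IH[OF w(1)] insert.prems(2) insert.hyps by auto
    have "(\<Sum>l\<in>J. (u(j := w)) l $ i * (u(j := w)) l $ k) = (\<Sum>l\<in>J. u l $ i * u l $ k)" for i k
      using insert.hyps by (intro sum.cong) auto
    then have "B = (\<chi> i k. \<Sum>l\<in>insert j J. (u(j := w)) l $ i * (u(j := w)) l $ k)"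
      using u insert.hyps by (simp add: vec_eq_iff algebra_simps)
    then show ?thesis by blast
  qed
qed

lemma factors_nonempty:
  fixes X :: "real^'n^'n"
  assumes "psd X" "rank X \<le> CARD('r)"
  shows "(factors X :: (real^'r^'n) set) \<noteq> {}"
proof -
  obtain u :: "'r \<Rightarrow> real^'n" where u: "X = (\<chi> i k. \<Sum>j\<in>UNIV. u j $ i * u j $ k)"
    using psd_factorization[OF assms(1), of "UNIV :: 'r set"] assms(2) by auto
  have "(\<chi> i j. u j $ i) ** transpose (\<chi> i j. u j $ i) = X"
    by (simp add: u vec_eq_iff matrix_matrix_mult_def transpose_def)
  then show ?thesis
    unfolding factors_def by blast
qed


section \<open>Singular values\<close>

text \<open>The minimum of the quadratic form of a self-adjoint operator over the unit sphere of an
  invariant subspace is attained, and a minimizer is an eigenvector: the first variation at the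
  minimizer vanishes in the subspace, and invariance keeps the residual inside the subspace.\<close>

lemma self_adjoint_min_eigenvector:
  fixes B :: "'a::euclidean_space \<Rightarrow> 'a"
  assumes lin: "linear B" and sa: "\<And>x y. B x \<bullet> y = x \<bullet> B y"
    and T: "subspace T" "T \<noteq> {0}" and inv: "\<And>x. x \<in> T \<Longrightarrow> B x \<in> T"
  obtains x \<mu> where "x \<in> T" "norm x = 1" "B x = \<mu> *\<^sub>R x" "\<And>y. y \<in> T \<Longrightarrow> \<mu> * (norm y)\<^sup>2 \<le> y \<bullet> B y"
proof -
  from T obtain z where z: "z \<in> T" "z \<noteq> 0"
    using subspace_0 by blast
  let ?K = "sphere 0 1 \<inter> T"
  have "(1 / norm z) *\<^sub>R z \<in> ?K"
    using z T by (simp add: subspace_scale)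
  then have ne: "?K \<noteq> {}" by blast
  have "compact ?K"
    by (simp add: closed_subspace T compact_Int_closed)
  moreover have "continuous_on ?K (\<lambda>y. y \<bullet> B y)"
    by (intro continuous_intros linear_continuous_on linear_conv_bounded_linear[THEN iffD1] lin)
  ultimately obtain x where x: "x \<in> ?K" and min: "\<And>y. y \<in> ?K \<Longrightarrow> x \<bullet> B x \<le> y \<bullet> B y"
    using ne continuous_attains_inf by metis
  define \<mu> where "\<mu> = x \<bullet> B x"
  have form: "\<mu> * (norm y)\<^sup>2 \<le> y \<bullet> B y" if "y \<in> T" for y
  proof (cases "y = 0")
    case False
    then have "(1 / norm y) *\<^sub>R y \<in> ?K"
      using that T by (simp add: subspace_scale)
    from min[OF this] False show ?thesis
      by (simp add: \<mu>_def linear_scale[OF lin] power2_eq_square field_simps)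
  qed (use lin in \<open>simp add: linear_0\<close>)
  define r where "r = B x - \<mu> *\<^sub>R x"
  have Bx: "B x = r + \<mu> *\<^sub>R x"
    by (simp add: r_def)
  have rT: "r \<in> T"
    unfolding r_def using x inv T by (intro subspace_diff subspace_scale) auto
  have xr: "x \<bullet> r = 0"
    using x by (simp add: r_def inner_diff_right \<mu>_def dot_square_norm)
  have key: "0 \<le> 2 * t * (norm r)\<^sup>2 + t\<^sup>2 * (r \<bullet> B r - \<mu> * (norm r)\<^sup>2)" for t
  proof -
    let ?y = "x + t *\<^sub>R r"
    have "?y \<in> T"
      using x rT T by (intro subspace_add subspace_scale) auto
    from form[OF this] have le: "\<mu> * (?y \<bullet> ?y) \<le> ?y \<bullet> B ?y"
      by (simp add: dot_square_norm)
    have yy: "?y \<bullet> ?y = 1 + t\<^sup>2 * (norm r)\<^sup>2"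
    proof -
      have "x \<bullet> x = 1"
        using x by (simp add: dot_square_norm)
      then show ?thesis
        using xr by (simp add: inner_add_left inner_add_right inner_commute[of r x]
            power2_norm_eq_inner power2_eq_square[of t])
    qed
    have yBy: "?y \<bullet> B ?y = \<mu> + 2 * t * (norm r)\<^sup>2 + t\<^sup>2 * (r \<bullet> B r)"
    proof -
      have rBx: "r \<bullet> B x = (norm r)\<^sup>2"
        using xr unfolding Bx by (simp add: inner_add_right inner_commute[of r x] dot_square_norm)
      then have "x \<bullet> B r = (norm r)\<^sup>2"
        using sa[of x r] by (simp add: inner_commute)
      with rBx show ?thesis
        by (simp add: linear_add[OF lin] linear_scale[OF lin] inner_add_left inner_add_right
            \<mu>_def power2_eq_square[of t] algebra_simps)
    qed
    show ?thesis
      using le unfolding yy yBy by (simp add: algebra_simps)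
  qed
  have "r = 0"
  proof (rule ccontr)
    assume "r \<noteq> 0"
    define a where "a = (norm r)\<^sup>2"
    define c where "c = r \<bullet> B r - \<mu> * a"
    have a: "a > 0"
      using \<open>r \<noteq> 0\<close> by (simp add: a_def)
    have q: "0 \<le> 2 * t * a + t\<^sup>2 * c" for t
      using key[of t] by (simp add: a_def c_def)
    have c: "c > 0"
      using q[of "-1"] a by simp
    have "2 * (- (a / c)) * a + (- (a / c))\<^sup>2 * c = - (a\<^sup>2 / c)"
      using c by (simp add: power2_eq_square field_simps)
    moreover have "a\<^sup>2 / c > 0"
      using a c by simp
    ultimately show False
      using q[of "- (a / c)"] by linarith
  qed
  then show thesis
    using that[of x \<mu>] x form by (simp add: r_def)
qed

text \<open>The right singular space of \<open>M\<close> for the singular value \<open>s\<close>.\<close>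

definition sv_space :: "real^'c^'m \<Rightarrow> real \<Rightarrow> (real^'c) set" where
  "sv_space M s = {v. (transpose M ** M) *v v = s\<^sup>2 *\<^sub>R v}"

definition sv_set :: "real^'c^'m \<Rightarrow> real set" where
  "sv_set M = {s. 0 \<le> s \<and> sv_space M s \<noteq> {0}}"

lemma singular_values_alt:
  "singular_values M
   = sorted_list_of_multiset (\<Sum>s\<in>sv_set M. replicate_mset (dim (sv_space M s)) s)"
  by (simp add: singular_values_def sv_space_def sv_set_def Let_def)

lemma inner_gram_matrix_vector:
  fixes M :: "real^'c^'m"
  shows "((transpose M ** M) *v x) \<bullet> y = (M *v x) \<bullet> (M *v y)"
  by (metis inner_matrix_vector inner_commute matrix_vector_mul_assoc)

lemma subspace_sv_space: "subspace (sv_space M s)"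
  by (auto simp: subspace_def sv_space_def matrix_vector_right_distrib matrix_vector_mult_scaleR
      scaleR_add_right)

lemma sv_spaces_orthogonal:
  assumes "x \<in> sv_space M s" "y \<in> sv_space M t" "s \<noteq> t" "0 \<le> s" "0 \<le> t"
  shows "x \<bullet> y = 0"
proof -
  have "s\<^sup>2 * (x \<bullet> y) = ((transpose M ** M) *v x) \<bullet> y"
    using assms(1) by (simp add: sv_space_def)
  also have "\<dots> = x \<bullet> ((transpose M ** M) *v y)"
    by (metis inner_gram_matrix_vector inner_commute)
  also have "\<dots> = t\<^sup>2 * (x \<bullet> y)"
    using assms(2) by (simp add: sv_space_def)
  finally have "x \<bullet> y = 0 \<or> s\<^sup>2 = t\<^sup>2"
    by auto
  then show ?thesis
    using assms by (auto simp: power2_eq_iff_nonneg)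
qed

lemma finite_sv_set: "finite (sv_set (M :: real^'c^'m))"
proof -
  have "\<forall>s\<in>sv_set M. \<exists>v. v \<in> sv_space M s \<and> v \<noteq> 0"
    using subspace_0[OF subspace_sv_space] by (auto simp: sv_set_def)
  then obtain g where g: "\<And>s. s \<in> sv_set M \<Longrightarrow> g s \<in> sv_space M s \<and> g s \<noteq> 0"
    by metis
  have orth: "g s \<bullet> g t = 0" if "s \<in> sv_set M" "t \<in> sv_set M" "s \<noteq> t" for s t
    using sv_spaces_orthogonal[of "g s" M s "g t" t] g that by (auto simp: sv_set_def)
  have inj: "inj_on g (sv_set M)"
    by (rule inj_onI) (metis g inner_eq_zero_iff orth)
  have "pairwise orthogonal (g ` sv_set M)"
    using orth by (auto simp: pairwise_def orthogonal_def)
  then have "independent (g ` sv_set M)"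
    using g by (intro pairwise_orthogonal_independent) auto
  then have "finite (g ` sv_set M)"
    by (rule independent_imp_finite)
  then show ?thesis
    using inj finite_image_iff by blast
qed

text \<open>The spectral theorem for \<open>M\<^sup>T M\<close>: otherwise the orthogonal complement of all eigenspaces
  would be a nonzero invariant subspace, hence would contain an eigenvector.\<close>

lemma span_sv_spaces: "span (\<Union>s\<in>sv_set M. sv_space M s) = UNIV" for M :: "real^'c^'m"
proof (rule ccontr)
  let ?N = "\<lambda>v. (transpose M ** M) *v v"
  let ?U = "\<Union>s\<in>sv_set M. sv_space M s"
  assume "span ?U \<noteq> UNIV"
  from span_not_UNIV_orthogonal[OF this]
  obtain a where a: "a \<noteq> 0" "\<And>x. x \<in> span ?U \<Longrightarrow> a \<bullet> x = 0"
    by blast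
  define T where "T = {x. \<forall>u\<in>?U. u \<bullet> x = 0}"
  have T: "subspace T"
    by (auto simp: T_def subspace_def inner_add_right)
  have "a \<in> T"
    using a(2)[OF span_base] by (auto simp: T_def inner_commute[of _ a])
  with a(1) have Tne: "T \<noteq> {0}" by blast
  have inv: "?N x \<in> T" if "x \<in> T" for x
    unfolding T_def
  proof safe
    fix s u assume s: "s \<in> sv_set M" "u \<in> sv_space M s"
    have "u \<bullet> ?N x = ?N u \<bullet> x"
      by (metis inner_gram_matrix_vector inner_commute)
    also have "\<dots> = s\<^sup>2 * (u \<bullet> x)"
      using s by (simp add: sv_space_def)
    finally show "u \<bullet> ?N x = 0"
      using that s by (auto simp: T_def)
  qed
  have sa: "?N x \<bullet> y = x \<bullet> ?N y" for x y
    by (metis inner_gram_matrix_vector inner_commute)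
  obtain x \<mu> where x: "x \<in> T" "norm x = 1" "?N x = \<mu> *\<^sub>R x"
    by (rule self_adjoint_min_eigenvector[where B = ?N, OF matrix_vector_mul_linear sa T Tne inv])
  have "?N x \<bullet> x = \<mu>"
    using x by (simp add: dot_square_norm)
  moreover have "0 \<le> ?N x \<bullet> x"
    unfolding inner_gram_matrix_vector by (rule inner_ge_zero)
  ultimately have "0 \<le> \<mu>"
    by (rule subst)
  then have "(sqrt \<mu>)\<^sup>2 = \<mu>"
    by simp
  with x(3) have ev: "x \<in> sv_space M (sqrt \<mu>)"
    unfolding sv_space_def mem_Collect_eq by (simp only:)
  have "x \<noteq> 0"
    using x(2) by auto
  with ev have "sv_space M (sqrt \<mu>) \<noteq> {0}"
    by blast
  with \<open>0 \<le> \<mu>\<close> have "sqrt \<mu> \<in> sv_set M"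
    unfolding sv_set_def by simp
  with ev x(1) have "x \<bullet> x = 0"
    unfolding T_def by blast
  with \<open>x \<noteq> 0\<close> show False
    by simp
qed

lemma sum_dim_sv_space: "(\<Sum>s\<in>sv_set M. dim (sv_space M s)) = CARD('c)" for M :: "real^'c^'m"
proof -
  have "\<exists>B. B \<subseteq> sv_space M s \<and> pairwise orthogonal B \<and> (\<forall>x\<in>B. norm x = 1)
      \<and> independent B \<and> card B = dim (sv_space M s) \<and> span B = sv_space M s" for s
    by (rule orthonormal_basis_subspace[OF subspace_sv_space[of M s]]) (intro exI conjI ballI)
  then obtain B where B': "\<And>s. B s \<subseteq> sv_space M s \<and> pairwise orthogonal (B s)
      \<and> (\<forall>x\<in>B s. norm x = 1) \<and> independent (B s)
      \<and> card (B s) = dim (sv_space M s) \<and> span (B s) = sv_space M s"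
    by (rule that[OF someI_ex])
  have B: "\<And>s. B s \<subseteq> sv_space M s" "\<And>s. pairwise orthogonal (B s)"
      "\<And>s x. x \<in> B s \<Longrightarrow> norm x = 1" "\<And>s. independent (B s)"
      "\<And>s. card (B s) = dim (sv_space M s)" "\<And>s. span (B s) = sv_space M s"
    using B' by blast+
  let ?B = "\<Union>s\<in>sv_set M. B s"
  have orth: "x \<bullet> y = 0" if "x \<in> B s" "y \<in> B t" "s \<noteq> t" "s \<in> sv_set M" "t \<in> sv_set M" for x y s t
    using sv_spaces_orthogonal[of x M s y t] B(1) that by (auto simp: sv_set_def)
  have disj: "B s \<inter> B t = {}" if "s \<noteq> t" "s \<in> sv_set M" "t \<in> sv_set M" for s t
  proof (rule ccontr)
    assume "B s \<inter> B t \<noteq> {}"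
    then obtain x where "x \<in> B s" "x \<in> B t" by blast
    then show False
      using orth[of x s x t] that B(3)[of x s] by auto
  qed
  have "pairwise orthogonal ?B"
    unfolding pairwise_def
  proof safe
    fix x y s t assume *: "s \<in> sv_set M" "x \<in> B s" "t \<in> sv_set M" "y \<in> B t" "x \<noteq> y"
    then show "orthogonal x y"
      using orth[of x s y t] B(2)[of s] by (cases "s = t") (auto simp: pairwise_def orthogonal_def)
  qed
  moreover have "0 \<notin> ?B"
    using B(3) by force
  ultimately have ind: "independent ?B"
    by (rule pairwise_orthogonal_independent)
  have "sv_space M s \<subseteq> span ?B" if "s \<in> sv_set M" for s
    using B(6)[of s] span_mono[of "B s" ?B] that by blast
  then have "span (\<Union>s\<in>sv_set M. sv_space M s) \<subseteq> span ?B"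
    by (intro span_minimal subspace_span) blast
  then have "span ?B = UNIV"
    using span_sv_spaces[of M] by auto
  then have "card ?B = CARD('c)"
    using ind dim_eq_card[of ?B UNIV] by simp
  moreover have "card ?B = (\<Sum>s\<in>sv_set M. card (B s))"
    by (intro card_UN_disjoint finite_sv_set ballI independent_imp_finite[OF B(4)]) (use disj in auto)
  ultimately show ?thesis
    by (simp add: B(5))
qed

text \<open>The full length makes the \<open>c\<close>-th largest singular value the first entry of the list.\<close>

lemma length_singular_values: "length (singular_values (M :: real^'c^'m)) = CARD('c)"
proof -
  have "length (singular_values M)
      = size (\<Sum>s\<in>sv_set M. replicate_mset (dim (sv_space M s)) s)"
    unfolding singular_values_alt size_mset[symmetric] mset_sorted_list_of_multiset ..
  also have "\<dots> = (\<Sum>s\<in>sv_set M. dim (sv_space M s))"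
    by (simp add: size_multiset_sum)
  finally show ?thesis
    by (simp add: sum_dim_sv_space)
qed

lemma sorted_singular_values: "sorted (singular_values M)"
  unfolding singular_values_alt by (rule sorted_sorted_list_of_multiset)

lemma in_singular_valuesI:
  assumes "x \<in> sv_space M s" "x \<noteq> 0" "0 \<le> s"
  shows "s \<in> set (singular_values M)"
proof -
  have s: "s \<in> sv_set M"
    using assms by (auto simp: sv_set_def)
  have "dim (sv_space M s) \<noteq> 0"
    using assms by (auto simp: dim_eq_0)
  then show ?thesis
    using s finite_sv_set[of M] unfolding singular_values_alt set_sorted_list_of_multiset
    by (simp add: set_mset_sum)
qed

lemma linear_gram_mult:
  fixes M :: "real^'c^'m"
  shows "linear (\<lambda>v. (transpose M ** M) *v v)" "linear (\<lambda>v. - ((transpose M ** M) *v v))"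
proof -
  show *: "linear (\<lambda>v. (transpose M ** M) *v v)"
    by (rule matrix_vector_mul_linear)
  show "linear (\<lambda>v. - ((transpose M ** M) *v v))"
    by (rule linear_compose_neg[OF *])
qed

lemma gram_form: "v \<bullet> ((transpose M ** M) *v v) = (norm (M *v v))\<^sup>2" for M :: "real^'c^'m"
  unfolding power2_norm_eq_inner inner_gram_matrix_vector[symmetric] by (rule inner_commute)

lemma UNIV_ne_0: "(UNIV :: (real^'c) set) \<noteq> {0}"
proof -
  have "(1 :: real^'c) \<noteq> 0"
    by (rule one_neq_zero)
  then show ?thesis
    by blast
qed

lemma norm_ge_smallest_singular_value:
  fixes M :: "real^'c^'m"
  assumes "0 \<le> \<gamma>" "\<gamma> \<le> nth_largest_sv CARD('c) M"
  shows "\<gamma> * norm v \<le> norm (M *v v)"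
proof -
  let ?N = "\<lambda>v. (transpose M ** M) *v v"
  have sa: "?N x \<bullet> y = x \<bullet> ?N y" for x y
    by (metis inner_gram_matrix_vector inner_commute)
  obtain x \<mu> where x: "norm x = 1" "?N x = \<mu> *\<^sub>R x" and form: "\<And>y. \<mu> * (norm y)\<^sup>2 \<le> y \<bullet> ?N y"
  proof (rule self_adjoint_min_eigenvector[where B = ?N, OF linear_gram_mult(1) sa subspace_UNIV UNIV_ne_0])
  qed (use that in \<open>simp_all only: UNIV_I simp_thms\<close>)
  have "x \<bullet> ?N x = \<mu>"
    using x by (simp add: dot_square_norm)
  moreover have "0 \<le> x \<bullet> ?N x"
    unfolding gram_form by (rule zero_le_power2)
  ultimately have \<mu>: "0 \<le> \<mu>"
    by (rule subst)
  have "sqrt \<mu> \<in> set (singular_values M)"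
    using x \<mu> by (intro in_singular_valuesI[of x]) (auto simp: sv_space_def)
  then obtain i where "i < CARD('c)" "singular_values M ! i = sqrt \<mu>"
    by (metis in_set_conv_nth length_singular_values)
  then have "singular_values M ! 0 \<le> sqrt \<mu>"
    using sorted_nth_mono[OF sorted_singular_values, of 0 i M] length_singular_values[of M] by simp
  moreover have "nth_largest_sv CARD('c) M = singular_values M ! 0"
    unfolding nth_largest_sv_def using length_singular_values[of M] by (simp add: rev_nth)
  ultimately have "\<gamma> \<le> sqrt \<mu>"
    using assms by simp
  then have "(\<gamma> * norm v)\<^sup>2 \<le> \<mu> * (norm v)\<^sup>2"
    using assms(1) \<mu> power_mono[of \<gamma> "sqrt \<mu>" 2]
    by (simp add: power_mult_distrib mult_right_mono)
  also have "\<dots> \<le> (norm (M *v v))\<^sup>2"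
    using form[of v] by (simp add: gram_form)
  finally show ?thesis
    by (rule power2_le_imp_le) simp
qed

lemma norm_le_largest_singular_value:
  fixes M :: "real^'c^'m"
  shows "norm (M *v v) \<le> nth_largest_sv 1 M * norm v"
proof -
  let ?N = "\<lambda>v. - ((transpose M ** M) *v v)"
  have sa: "?N x \<bullet> y = x \<bullet> ?N y" for x y
    by (metis inner_gram_matrix_vector inner_commute inner_minus_left inner_minus_right)
  obtain x \<mu> where x: "norm x = 1" "?N x = \<mu> *\<^sub>R x" and form: "\<And>y. \<mu> * (norm y)\<^sup>2 \<le> y \<bullet> ?N y"
  proof (rule self_adjoint_min_eigenvector[where B = ?N, OF linear_gram_mult(2) sa subspace_UNIV UNIV_ne_0])
  qed (use that in \<open>simp_all only: UNIV_I simp_thms\<close>)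
  have "x \<bullet> ?N x = \<mu>"
    unfolding x(2) using x(1) by (simp add: dot_square_norm)
  moreover have "x \<bullet> ?N x \<le> 0"
    unfolding inner_minus_right gram_form by simp
  ultimately have \<mu>: "\<mu> \<le> 0"
    by (rule subst)
  have ev: "(transpose M ** M) *v x = (- \<mu>) *\<^sub>R x"
    using x(2) by (metis minus_minus scaleR_minus_left)
  have "sqrt (- \<mu>) \<in> set (singular_values M)"
    using x(1) ev \<mu> by (intro in_singular_valuesI[of x]) (auto simp: sv_space_def)
  then obtain i where "i < CARD('c)" "singular_values M ! i = sqrt (- \<mu>)"
    by (metis in_set_conv_nth length_singular_values)
  then have "sqrt (- \<mu>) \<le> singular_values M ! (CARD('c) - 1)"
    using sorted_nth_mono[OF sorted_singular_values, of i "CARD('c) - 1" M]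
      length_singular_values[of M] by simp
  moreover have "nth_largest_sv 1 M = singular_values M ! (CARD('c) - 1)"
    unfolding nth_largest_sv_def using length_singular_values[of M] by (simp add: rev_nth)
  ultimately have \<sigma>: "sqrt (- \<mu>) \<le> nth_largest_sv 1 M"
    by simp
  have "(norm (M *v v))\<^sup>2 \<le> - \<mu> * (norm v)\<^sup>2"
    using form[of v] by (simp add: gram_form)
  also have "\<dots> = (sqrt (- \<mu>) * norm v)\<^sup>2"
    using \<mu> by (simp add: power_mult_distrib)
  finally have "norm (M *v v) \<le> sqrt (- \<mu>) * norm v"
    by (rule power2_le_imp_le) (use \<mu> in simp)
  also have "\<dots> \<le> nth_largest_sv 1 M * norm v"
    using \<sigma> by (rule mult_right_mono) simp
  finally show ?thesis .
qed


section \<open>The set of factors\<close>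

lemma closed_factors: "closed (factors X)"
  unfolding factors_def by (intro closed_Collect_eq continuous_on_gram continuous_on_const)

lemma norm_factors_eq:
  assumes "R \<in> factors X" "T \<in> factors X"
  shows "norm R = norm T"
proof -
  have "(norm R)\<^sup>2 = (norm T)\<^sup>2"
    using assms by (simp add: norm_squared_gram factors_def)
  then show ?thesis
    by (simp add: power2_eq_iff_nonneg)
qed

lemma factors_subset_nbhd: "0 < \<delta> \<Longrightarrow> S \<subseteq> nbhd S \<delta>"
  by (auto simp: nbhd_def)

lemma nearest_factor:
  fixes R :: "real^'r^'n"
  assumes "(factors X :: (real^'r^'n) set) \<noteq> {}"
  obtains T where "T \<in> factors X" "infdist R (factors X) = norm (R - T)"
  using infdist_attains_inf[OF closed_factors assms, of R] by (metis dist_norm)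

text \<open>All factors of \<open>X\<close> have the same norm, since \<open>\<parallel>R\<parallel>\<^sup>2\<close> is the trace of \<open>R R\<^sup>T\<close>. So the bound may be
  stated with an arbitrary factor \<open>T\<close> in place of the nearest one.\<close>

lemma gram_dist_le:
  fixes R T :: "real^'r^'n"
  assumes "T \<in> factors X" "infdist R (factors X) \<le> 1"
  shows "norm (R ** transpose R - X) \<le> (2 * norm T + 1) * infdist R (factors X)"
proof -
  obtain T' where T': "T' \<in> factors X" "infdist R (factors X) = norm (R - T')"
    using nearest_factor assms(1) by blast
  have "norm R \<le> norm T' + norm (R - T')"
    using norm_triangle_ineq[of T' "R - T'"] by simp
  then have "norm R + norm T' \<le> 2 * norm T + 1"
    using norm_factors_eq[OF T'(1) assms(1)] assms(2) T'(2) by simp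
  moreover have "norm (R ** transpose R - X) \<le> (norm R + norm T') * norm (R - T')"
    using norm_diff_gram_le[of R T'] T'(1) by (simp add: factors_def)
  ultimately show ?thesis
    unfolding T'(2) by (meson mult_right_mono norm_ge_zero order_trans)
qed


section \<open>The exact penalty function on symmetric matrices\<close>

lemma linear_meas_op: "linear (meas_op A)" for A :: "'k::finite \<Rightarrow> real^'n^'n"
  unfolding meas_op_def by (rule linearI) (simp_all add: vec_eq_iff inner_add_right)

lemmas meas_op_add = linear_add[OF linear_meas_op]
  and meas_op_diff = linear_diff[OF linear_meas_op]
  and meas_op_scaleR = linear_scale[OF linear_meas_op]

lemma meas_op_onorm_bdd:
  fixes A :: "'k::finite \<Rightarrow> real^'n^'n"
  shows "bdd_above ((\<lambda>X. norm (meas_op A X) / norm X) ` sym_mats)"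
proof -
  obtain K where K: "K > 0" "\<And>X. norm (meas_op A X) \<le> norm X * K"
    using linear_bounded_pos[OF linear_meas_op[of A]] by (auto simp: mult.commute)
  have "norm (meas_op A X) / norm X \<le> K" for X
    using K by (cases "X = 0") (simp_all add: pos_divide_le_eq mult.commute)
  then show ?thesis
    by (intro bdd_aboveI2)
qed

lemma onorm_meas_op_nonneg:
  fixes A :: "'k::finite \<Rightarrow> real^'n^'n"
  shows "0 \<le> onorm_on sym_mats (meas_op A)"
  unfolding onorm_on_def
  using cSUP_upper[OF sym_mats_zero meas_op_onorm_bdd[of A]] by simp

lemma norm_meas_op_le:
  fixes A :: "'k::finite \<Rightarrow> real^'n^'n"
  assumes "X \<in> sym_mats"
  shows "norm (meas_op A X) \<le> onorm_on sym_mats (meas_op A) * norm X"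
proof (cases "X = 0")
  case True
  then show ?thesis
    by (simp add: linear_0[OF linear_meas_op])
next
  case False
  have "norm (meas_op A X) / norm X \<le> onorm_on sym_mats (meas_op A)"
    unfolding onorm_on_def by (rule cSUP_upper[OF assms meas_op_onorm_bdd])
  then show ?thesis
    using False by (simp add: pos_divide_le_eq)
qed

lemma h_fun_lipschitz:
  fixes A :: "'k::finite \<Rightarrow> real^'n^'n"
  assumes f: "L-lipschitz_on U f" and U: "U \<subseteq> sym_mats" and lam: "0 \<le> lam"
  shows "(L + lam * onorm_on sym_mats (meas_op A))-lipschitz_on U (h_fun f A b lam)"
proof (rule lipschitz_onI)
  fix X Y assume XY: "X \<in> U" "Y \<in> U"
  have "\<bar>f X - f Y\<bar> \<le> L * norm (X - Y)"
    using lipschitz_onD[OF f XY] by (simp add: dist_norm)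
  moreover have "\<bar>norm (meas_op A X - b) - norm (meas_op A Y - b)\<bar>
      \<le> onorm_on sym_mats (meas_op A) * norm (X - Y)"
  proof -
    have "\<bar>norm (meas_op A X - b) - norm (meas_op A Y - b)\<bar> \<le> norm (meas_op A (X - Y))"
      using norm_triangle_ineq3[of "meas_op A X - b" "meas_op A Y - b"] by (simp add: meas_op_diff)
    also have "\<dots> \<le> onorm_on sym_mats (meas_op A) * norm (X - Y)"
      using XY U by (intro norm_meas_op_le sym_mats_diff) auto
    finally show ?thesis .
  qed
  then have "\<bar>lam * norm (meas_op A X - b) - lam * norm (meas_op A Y - b)\<bar>
      \<le> lam * (onorm_on sym_mats (meas_op A) * norm (X - Y))"
    using lam by (simp add: right_diff_distrib[symmetric] abs_mult mult_left_mono)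
  ultimately show "dist (h_fun f A b lam X) (h_fun f A b lam Y)
      \<le> (L + lam * onorm_on sym_mats (meas_op A)) * dist X Y"
    unfolding h_fun_def dist_norm by (simp add: algebra_simps)
qed (use lam lipschitz_on_nonneg[OF f] in \<open>simp add: onorm_meas_op_nonneg\<close>)

lemma convex_on_h_fun:
  fixes A :: "'k::finite \<Rightarrow> real^'n^'n"
  assumes "convex_on sym_mats f" "0 \<le> lam"
  shows "convex_on sym_mats (h_fun f A b lam)"
proof -
  have "convex_on sym_mats (\<lambda>X. norm (meas_op A X - b))"
  proof (rule convex_onI)
    fix t :: real and X Y assume t: "0 < t" "t < 1"
    have "meas_op A ((1 - t) *\<^sub>R X + t *\<^sub>R Y) - b
        = (1 - t) *\<^sub>R (meas_op A X - b) + t *\<^sub>R (meas_op A Y - b)"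
      unfolding meas_op_add meas_op_scaleR by (simp add: algebra_simps)
    then show "norm (meas_op A ((1 - t) *\<^sub>R X + t *\<^sub>R Y) - b)
        \<le> (1 - t) * norm (meas_op A X - b) + t * norm (meas_op A Y - b)"
      using t norm_triangle_ineq[of "(1 - t) *\<^sub>R (meas_op A X - b)" "t *\<^sub>R (meas_op A Y - b)"]
      by simp
  qed (rule convex_sym_mats)
  then show ?thesis
    unfolding h_fun_def using assms by (intro convex_on_add convex_on_cmul)
qed


section \<open>Restoring feasibility of the linearized constraint\<close>

lemma M_mat_mult_vec:
  "(M_mat A R *v z) $ p = (\<Sum>i\<in>UNIV. z $ i *\<^sub>R (A i ** R)) $ fst p $ snd p"
  by (simp add: matrix_vector_mult_def M_mat_def mult.commute)

lemma norm_M_mat_mult_vec: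
  "norm (M_mat A R *v z) = norm (\<Sum>i\<in>UNIV. z $ i *\<^sub>R (A i ** R))"
proof -
  let ?T = "\<Sum>i\<in>UNIV. z $ i *\<^sub>R (A i ** R)"
  have "(M_mat A R *v z) \<bullet> (M_mat A R *v z)
      = (\<Sum>p\<in>UNIV \<times> UNIV. ?T $ fst p $ snd p * ?T $ fst p $ snd p)"
    unfolding inner_vec_def[of "M_mat A R *v z"] M_mat_mult_vec by simp
  also have "\<dots> = ?T \<bullet> ?T"
    unfolding inner_vec_def by (simp add: sum.cartesian_product case_prod_beta)
  finally show ?thesis
    by (simp add: norm_eq_sqrt_inner)
qed

text \<open>The least-norm solution of the linearized constraint, \<open>W = M (M\<^sup>T M)\<^sup>-\<^sup>1 a / 2\<close> with
  \<open>M = M_mat A R\<close>.\<close>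

lemma linearized_constraint_solvable:
  fixes A :: "'k::finite \<Rightarrow> real^'n^'n" and R :: "real^'r^'n" and a :: "real^'k"
  assumes A: "\<And>i. A i \<in> sym_mats" and "0 < \<gamma>"
    and cq: "\<And>z. \<gamma> * norm z \<le> norm (M_mat A R *v z)"
  obtains W where "meas_op A (sym_prod R W) = a" "norm W \<le> norm a / (2 * \<gamma>)"
proof -
  define T where "T z = (\<Sum>i\<in>UNIV. z $ i *\<^sub>R (A i ** R))" for z :: "real^'k"
  define T' where "T' W = (\<chi> i. (A i ** R) \<bullet> W)" for W
  have adj: "z \<bullet> T' W = T z \<bullet> W" for z W
    by (simp add: T_def T'_def inner_vec_def[of z] inner_sum_left)
  have linT: "linear T"
    unfolding T_def by (rule linearI) (simp_all add: scaleR_add_left sum.distrib scaleR_sum_right)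
  have linT': "linear T'"
    unfolding T'_def by (rule linearI) (simp_all add: vec_eq_iff inner_add_right)
  have lin: "linear (T' \<circ> T)"
    by (rule linear_compose[OF linT linT'])
  have bd: "\<gamma> * norm z \<le> norm (T z)" for z
    using cq[of z] by (simp add: T_def norm_M_mat_mult_vec)
  have "inj (T' \<circ> T)"
    unfolding linear_injective_0[OF lin]
  proof safe
    fix z assume "(T' \<circ> T) z = 0"
    with adj[of z "T z"] have "T z = 0"
      by simp
    with bd[of z] \<open>0 < \<gamma>\<close> show "z = 0"
      by (simp add: mult_le_0_iff)
  qed
  then have "surj (T' \<circ> T)"
    using lin linear_injective_imp_surjective by blast
  then obtain z where z: "T' (T z) = (1/2) *\<^sub>R a"
    by (metis comp_apply surjD)
  define W where "W = T z"
  have "A i \<bullet> sym_prod R W = a $ i" for i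
    using arg_cong[OF z, of "\<lambda>v. v $ i"] by (simp add: inner_sym_prod[OF A] T'_def W_def)
  then have "meas_op A (sym_prod R W) = a"
    by (simp add: meas_op_def vec_eq_iff)
  moreover have "norm W \<le> norm a / (2 * \<gamma>)"
  proof (cases "W = 0")
    case True
    then show ?thesis
      using \<open>0 < \<gamma>\<close> by simp
  next
    case False
    have "norm W * norm W = z \<bullet> ((1/2) *\<^sub>R a)"
      using adj[of z W] by (simp add: z[folded W_def] W_def[symmetric] dot_square_norm power2_eq_square)
    also have "\<dots> \<le> norm z * (norm a / 2)"
      using norm_cauchy_schwarz[of z "(1/2) *\<^sub>R a"] by simp
    finally have "\<gamma> * (norm W * norm W) \<le> (\<gamma> * norm z) * (norm a / 2)"
      using \<open>0 < \<gamma>\<close> by (simp add: mult.assoc)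
    also have "\<dots> \<le> norm W * (norm a / 2)"
      using bd[of z] by (intro mult_right_mono) (simp_all add: W_def)
    finally show ?thesis
      using False \<open>0 < \<gamma>\<close> by (simp add: field_simps)
  qed
  ultimately show thesis
    by (rule that)
qed

text \<open>With \<open>D = R - T\<close> for the nearest factor \<open>T\<close>, the direction \<open>- D\<close> turns the linearization into
  \<open>X - D D\<^sup>T\<close>, and a correction \<open>W\<close> of second order in \<open>d = \<parallel>D\<parallel>\<close> restores feasibility. The resulting
  perturbation \<open>E\<close> of \<open>X\<close> satisfies \<open>\<A> E = 0\<close> and \<open>\<parallel>E\<parallel> = O(d\<^sup>2)\<close>, hence \<open>f (X + E) - f X\<close> equals
  \<open>\<langle>Z, E\<rangle> + o(d\<^sup>2)\<close>, and \<open>\<langle>Z, E\<rangle> \<le> 2 \<langle>Z D, W\<rangle> = O(d\<^sup>3)\<close>.\<close>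

lemma second_order_feasible_direction:
  fixes f :: "real^'n^'n \<Rightarrow> real" and A :: "'k::finite \<Rightarrow> real^'n^'n"
    and S :: "(real^'r^'n) set"
  assumes A: "\<And>i. A i \<in> sym_mats" and S: "S = factors X" "S \<noteq> {}"
    and feas: "meas_op A X = b" and dual: "dual_optimum f A X y Z"
    and "0 < \<gamma>" "0 < \<delta>\<gamma>" and cq: "\<And>R z. R \<in> nbhd S \<delta>\<gamma> \<Longrightarrow> \<gamma> * norm z \<le> norm (M_mat A R *v z)"
    and "0 < \<kappa>"
  shows "\<exists>\<delta>>0. \<forall>R\<in>nbhd S \<delta>. \<exists>V. norm V \<le> 2 * infdist R S \<and>
      h_fun f A b lam (R ** transpose R + sym_prod R V) \<le> f X + \<kappa> * (infdist R S)\<^sup>2"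
proof -
  from S obtain T0 where T0: "T0 \<in> S" by blast
  define B where "B = norm T0 + 1"
  define K where "K = onorm_on sym_mats (meas_op A)"
  define C where "C = K / (2 * \<gamma>)"
  have B: "1 \<le> B" and K: "0 \<le> K" and C: "0 \<le> C"
    using \<open>0 < \<gamma>\<close> by (auto simp: B_def K_def C_def onorm_meas_op_nonneg)
  from dual obtain G where Z: "psd Z" "Z \<bullet> X = 0" and G: "has_sym_gradient f G X"
    and GZ: "G + (\<Sum>i\<in>UNIV. y $ i *\<^sub>R A i) - Z = 0"
    by (auto simp: dual_optimum_def)
  define c where "c = 1 + 2 * B * C"
  have c: "1 \<le> c"
    using B C by (simp add: c_def)
  have "X \<in> sym_mats"
    using T0 gram_in_sym_mats[of T0] by (simp add: S factors_def)
  define \<epsilon> where "\<epsilon> = \<kappa> / (2 * c)"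
  have "0 < \<epsilon>"
    using c \<open>0 < \<kappa>\<close> by (simp add: \<epsilon>_def)
  then obtain \<delta>f where \<delta>f: "0 < \<delta>f"
    "\<And>Y. Y \<in> sym_mats \<Longrightarrow> norm (Y - X) < \<delta>f \<Longrightarrow>
        norm (f Y - f X - G \<bullet> (Y - X)) \<le> \<epsilon> * norm (Y - X)"
    using G unfolding has_sym_gradient_def has_derivative_within_alt by meson
  define \<delta> where "\<delta> = Min {1, \<delta>\<gamma>, \<delta>f / c, 1 / (C + 1), \<kappa> / (4 * (norm Z * C + 1))}"
  have ZC: "0 < norm Z * C + 1"
    using C by (simp add: add_nonneg_pos)
  have "0 < \<delta>"
    using \<open>0 < \<delta>\<gamma>\<close> \<delta>f c C ZC \<open>0 < \<kappa>\<close> by (simp add: \<delta>_def)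
  show ?thesis
  proof (intro exI[of _ \<delta>] conjI ballI)
    fix R assume R: "R \<in> nbhd S \<delta>"
    define d where "d = infdist R S"
    have "d < \<delta>"
      using R by (simp add: nbhd_def d_def)
    then have d: "d < 1" "d < \<delta>\<gamma>" "d < \<delta>f / c" "d < 1 / (C + 1)"
        "d < \<kappa> / (4 * (norm Z * C + 1))" and d0: "0 \<le> d"
      by (simp_all add: \<delta>_def d_def infdist_nonneg)
    have Cd: "C * d \<le> 1"
      using d(4) d0 C by (simp add: pos_less_divide_eq distrib_left mult.commute)
    have cd: "c * d < \<delta>f"
      using d(3) c by (simp add: pos_less_divide_eq mult.commute)
    have ZCd: "2 * (norm Z * C) * d \<le> \<kappa> / 2"
    proof -
      have "d * (4 * (norm Z * C + 1)) < \<kappa>"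
        using d(5) ZC by (simp add: pos_less_divide_eq)
      then show ?thesis
        using d0 by (simp add: algebra_simps)
    qed
    obtain T where T: "T \<in> factors X" "d = norm (R - T)"
      using nearest_factor[of X R] S by (metis d_def)
    define D where "D = R - T"
    have D: "norm D = d"
      using T by (simp add: D_def)
    have normR: "norm R \<le> B"
      using norm_triangle_ineq[of T D] norm_factors_eq[OF T(1), of T0] T0 S D d
      by (simp add: D_def B_def)
    obtain W where W: "meas_op A (sym_prod R W) = meas_op A (D ** transpose D)"
        "norm W \<le> norm (meas_op A (D ** transpose D)) / (2 * \<gamma>)"
      using linearized_constraint_solvable[OF A \<open>0 < \<gamma>\<close> cq] d(2)
      by (metis (mono_tags, lifting) d_def mem_Collect_eq nbhd_def)
    have "norm (meas_op A (D ** transpose D)) \<le> K * norm (D ** transpose D)"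
      unfolding K_def by (intro norm_meas_op_le gram_in_sym_mats)
    also have "\<dots> \<le> K * d\<^sup>2"
      using K norm_gram_le[of D] D by (intro mult_left_mono) auto
    finally have "norm W \<le> (K * d\<^sup>2) / (2 * \<gamma>)"
      using W(2) \<open>0 < \<gamma>\<close> by (meson divide_right_mono less_eq_real_def mult_nonneg_nonneg
          order_trans zero_le_numeral)
    then have normW: "norm W \<le> C * d\<^sup>2"
      by (simp add: C_def)
    \<comment> \<open>\<open>V\<close> leads from \<open>R\<close> to the nearest factor \<open>T\<close>, up to a second-order correction.\<close>
    define V where "V = W - D"
    define E where "E = sym_prod R W - D ** transpose D"
    have "C * d\<^sup>2 \<le> d"
      using mult_right_mono[OF Cd d0] by (simp add: power2_eq_square mult.assoc)
    then have "norm V \<le> 2 * d"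
      using norm_triangle_ineq4[of W D] normW D by (simp add: V_def)
    moreover
    have "R ** transpose R + sym_prod R V = X + E"
    proof -
      have "R ** transpose R + sym_prod R (- D) + D ** transpose D = X"
        using gram_add[of R "- D"] T
        by (simp add: D_def factors_def transpose_diff matmul.diff_left matmul.diff_right)
      moreover have "sym_prod R V = sym_prod R W + sym_prod R (- D)"
        by (simp add: V_def sym_prod_add[symmetric])
      ultimately show ?thesis
        by (simp add: E_def algebra_simps)
    qed
    moreover have "h_fun f A b lam (X + E) \<le> f X + \<kappa> * d\<^sup>2"
    proof -
      have E: "E \<in> sym_mats"
        unfolding E_def by (intro sym_mats_diff sym_prod_in_sym_mats gram_in_sym_mats)
      have mE: "meas_op A E = 0"
        by (simp add: E_def meas_op_diff W)
      have normE: "norm E \<le> c * d\<^sup>2"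
      proof -
        have "norm (sym_prod R W) \<le> 2 * norm R * norm W"
          by (rule norm_sym_prod_le)
        also have "\<dots> \<le> 2 * B * (C * d\<^sup>2)"
          using normR normW B by (intro mult_mono) auto
        finally show ?thesis
          using norm_triangle_ineq4[of "sym_prod R W" "D ** transpose D"] norm_gram_le[of D] D
          by (simp add: E_def c_def algebra_simps)
      qed
      have "d\<^sup>2 \<le> d"
        using d0 d(1) by (simp add: power2_eq_square mult_left_le)
      with c have "c * d\<^sup>2 \<le> c * d"
        by (intro mult_left_mono) auto
      with normE cd have "norm E < \<delta>f" by linarith
      then have "norm (f (X + E) - f X - G \<bullet> E) \<le> \<epsilon> * norm E"
        using \<delta>f(2)[of "X + E"] E \<open>X \<in> sym_mats\<close> by (simp add: sym_mats_add)
      moreover have "\<epsilon> * norm E \<le> (\<kappa> / 2) * d\<^sup>2"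
      proof -
        have "\<epsilon> * norm E \<le> \<epsilon> * (c * d\<^sup>2)"
          using normE \<open>0 < \<epsilon>\<close> by (intro mult_left_mono) auto
        then show ?thesis
          using c by (simp add: \<epsilon>_def)
      qed
      moreover
      \<comment> \<open>\<open>G\<close> and \<open>Z\<close> agree on \<open>E\<close> since \<open>E\<close> is tangent to the constraints, and \<open>Z\<close> annihilates
        every factor of \<open>X\<close>, so that \<open>Z R = Z D\<close> is small.\<close>
      have "G \<bullet> E \<le> (\<kappa> / 2) * d\<^sup>2"
      proof -
        have "G = Z - (\<Sum>i\<in>UNIV. y $ i *\<^sub>R A i)"
          using GZ by (simp add: algebra_simps)
        moreover have "A i \<bullet> E = 0" for i
          using arg_cong[OF mE, of "\<lambda>v. v $ i"] by (simp add: meas_op_def)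
        ultimately have "G \<bullet> E = Z \<bullet> E"
          by (simp add: inner_diff_left inner_sum_left)
        also have "\<dots> \<le> Z \<bullet> sym_prod R W"
          using psd_inner_gram_nonneg[OF Z(1), of D] by (simp add: E_def inner_diff_right)
        also have "\<dots> = 2 * ((Z ** D) \<bullet> W)"
        proof -
          have "Z ** T = 0"
            using psd_annihilates_factor[OF Z(1), of T] Z(2) T by (simp add: factors_def)
          then have "Z ** R = Z ** D"
            by (simp add: D_def matmul.diff_right)
          then show ?thesis
            using Z by (simp add: inner_sym_prod psd_def)
        qed
        also have "(Z ** D) \<bullet> W \<le> norm Z * d * (C * d\<^sup>2)"
        proof -
          have "(Z ** D) \<bullet> W \<le> norm (Z ** D) * norm W"
            by (rule norm_cauchy_schwarz)
          also have "\<dots> \<le> norm Z * d * (C * d\<^sup>2)"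
            using norm_matrix_mul_le[of Z D] D normW d0 by (intro mult_mono) auto
          finally show ?thesis .
        qed
        also have "2 * (norm Z * d * (C * d\<^sup>2)) = (2 * (norm Z * C) * d) * d\<^sup>2"
          by simp
        also have "\<dots> \<le> (\<kappa> / 2) * d\<^sup>2"
          using ZCd by (rule mult_right_mono) simp
        finally show ?thesis
          by simp
      qed
      ultimately have "f (X + E) \<le> f X + \<kappa> * d\<^sup>2"
        by (simp add: abs_le_iff)
      moreover have "meas_op A (X + E) - b = 0"
        by (simp add: meas_op_add mE feas)
      ultimately show ?thesis
        by (simp add: h_fun_def)
    qed
    ultimately show "\<exists>V. norm V \<le> 2 * infdist R S \<and>
        h_fun f A b lam (R ** transpose R + sym_prod R V) \<le> f X + \<kappa> * (infdist R S)\<^sup>2"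
      by (auto simp: d_def)
  qed (rule \<open>0 < \<delta>\<close>)
qed


section \<open>The proximal step\<close>

lemma norm_convex_combination:
  fixes u v :: "'a::real_inner"
  shows "(norm ((1 - s) *\<^sub>R u + s *\<^sub>R v))\<^sup>2
      = (1 - s) * (norm u)\<^sup>2 + s * (norm v)\<^sup>2 - s * (1 - s) * (norm (v - u))\<^sup>2"
  unfolding power2_norm_eq_inner
  by (simp add: inner_add_left inner_add_right inner_diff_left inner_diff_right inner_commute[of v u]
      algebra_simps)

text \<open>A lower bound for the proximal objective that is only known on a ball already localizes the
  proximal point: by strong convexity, the minimizer over the ball lies in its interior as soon as
  the bound is close to the value at the centre, hence it is the global minimizer.\<close>

lemma prox_point_localized:
  fixes g :: "'a::euclidean_space \<Rightarrow> real"
  assumes g: "convex_on UNIV g" and pos: "0 < \<eta>" "0 < \<rho>"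
    and lower: "\<And>y. norm (y - x) \<le> \<rho> \<Longrightarrow> c \<le> g y + \<eta> * (norm (y - x))\<^sup>2"
    and close: "2 * (g x - c) < \<eta> * \<rho>\<^sup>2"
  defines "p \<equiv> arg_min (\<lambda>y. g y + \<eta> * (norm (y - x))\<^sup>2) (\<lambda>_. True)"
  shows "norm (p - x) < \<rho>"
    and "g p + \<eta> * (norm (p - x))\<^sup>2 \<le> g y + \<eta> * (norm (y - x))\<^sup>2"
proof -
  define m where "m y = g y + \<eta> * (norm (y - x))\<^sup>2" for y
  have strong: "m ((1 - s) *\<^sub>R u + s *\<^sub>R v)
      \<le> (1 - s) * m u + s * m v - \<eta> * s * (1 - s) * (norm (v - u))\<^sup>2"
    if "0 \<le> s" "s \<le> 1" for s u v
  proof -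
    have "g ((1 - s) *\<^sub>R u + s *\<^sub>R v) \<le> (1 - s) * g u + s * g v"
      using convex_onD[OF g that] by simp
    moreover have "(1 - s) *\<^sub>R u + s *\<^sub>R v - x = (1 - s) *\<^sub>R (u - x) + s *\<^sub>R (v - x)"
      by (simp add: algebra_simps)
    then have "(norm ((1 - s) *\<^sub>R u + s *\<^sub>R v - x))\<^sup>2
        = (1 - s) * (norm (u - x))\<^sup>2 + s * (norm (v - x))\<^sup>2 - s * (1 - s) * (norm (v - u))\<^sup>2"
      by (simp only: norm_convex_combination) simp
    then have "\<eta> * (norm ((1 - s) *\<^sub>R u + s *\<^sub>R v - x))\<^sup>2
        = (1 - s) * (\<eta> * (norm (u - x))\<^sup>2) + s * (\<eta> * (norm (v - x))\<^sup>2)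
          - \<eta> * s * (1 - s) * (norm (v - u))\<^sup>2"
      by (simp only:) (simp add: algebra_simps)
    ultimately show ?thesis
      unfolding m_def distrib_left by linarith
  qed
  have "continuous_on (cball x \<rho>) m"
    unfolding m_def
    by (intro continuous_intros continuous_on_subset[OF convex_on_continuous[OF open_UNIV g]]) auto
  then obtain q where q: "q \<in> cball x \<rho>" "\<And>y. y \<in> cball x \<rho> \<Longrightarrow> m q \<le> m y"
    using continuous_attains_inf[of "cball x \<rho>" m] pos by fastforce
  \<comment> \<open>Strong convexity between \<open>q\<close> and the midpoint of \<open>q\<close> and \<open>x\<close>.\<close>
  have "\<eta> * (norm (x - q))\<^sup>2 \<le> 2 * (m x - m q)"
  proof -
    have "(1 - 1/2) *\<^sub>R q + (1/2) *\<^sub>R x \<in> cball x \<rho>"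
      using q(1) pos by (intro convexD[OF convex_cball]) auto
    from q(2)[OF this] strong[of "1/2" q x] show ?thesis
      by simp
  qed
  also have "\<dots> < \<eta> * \<rho>\<^sup>2"
    using lower[of q] q(1) close by (simp add: m_def dist_norm norm_minus_commute)
  finally have "(norm (x - q))\<^sup>2 < \<rho>\<^sup>2"
    using pos by simp
  then have near: "norm (q - x) < \<rho>"
    using pos by (metis norm_minus_commute power2_less_imp_less less_imp_le)
  have glob: "m q < m y" if "y \<noteq> q" for y
  proof -
    define s where "s = min (1/2) ((\<rho> - norm (q - x)) / norm (y - q))"
    have n: "0 < norm (y - q)"
      using that by simp
    have s: "0 < s" "s \<le> 1/2"
    proof -
      show "0 < s"
        using near n by (simp add: s_def)
      show "s \<le> 1/2"
        unfolding s_def by (rule min.cobounded1)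
    qed
    have "s \<le> (\<rho> - norm (q - x)) / norm (y - q)"
      unfolding s_def by (rule min.cobounded2)
    then have le: "s * norm (y - q) \<le> \<rho> - norm (q - x)"
      using n by (simp only: pos_le_divide_eq)
    have "norm ((1 - s) *\<^sub>R q + s *\<^sub>R y - x) = norm ((q - x) + s *\<^sub>R (y - q))"
      by (rule arg_cong[where f = norm]) (simp add: algebra_simps)
    also have "\<dots> \<le> norm (q - x) + norm (s *\<^sub>R (y - q))"
      by (rule norm_triangle_ineq)
    also have "norm (s *\<^sub>R (y - q)) = s * norm (y - q)"
      using s(1) by simp
    also have "norm (q - x) + \<dots> \<le> \<rho>"
      using le by linarith
    finally have "norm ((1 - s) *\<^sub>R q + s *\<^sub>R y - x) \<le> \<rho>" .
    then have "(1 - s) *\<^sub>R q + s *\<^sub>R y \<in> cball x \<rho>"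
      by (simp add: dist_norm norm_minus_commute)
    from q(2)[OF this] have "m q \<le> (1 - s) * m q + s * m y - \<eta> * s * (1 - s) * (norm (y - q))\<^sup>2"
      using strong[of s q y] s by simp
    then have "s * (\<eta> * (1 - s) * (norm (y - q))\<^sup>2) \<le> s * (m y - m q)"
      by (simp add: algebra_simps)
    then have "\<eta> * (1 - s) * (norm (y - q))\<^sup>2 \<le> m y - m q"
      using s by simp
    moreover have "0 < \<eta> * (1 - s) * (norm (y - q))\<^sup>2"
      using pos s n by simp
    ultimately show ?thesis
      by simp
  qed
  have le: "m q \<le> m y" for y
    using glob[of y] by (cases "y = q") auto
  have "is_arg_min m (\<lambda>_. True) z \<longleftrightarrow> z = q" for z
    using le glob[of z] by (auto simp: is_arg_min_linorder dest: leD)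
  then have "arg_min m (\<lambda>_. True) = q"
    by (simp add: arg_min_def)
  then have "p = q"
    unfolding p_def m_def .
  with near le[of y] show "norm (p - x) < \<rho>"
    "g p + \<eta> * (norm (p - x))\<^sup>2 \<le> g y + \<eta> * (norm (y - x))\<^sup>2"
    unfolding m_def by simp_all
qed

lemma prox_linear_step_alt:
  "prox_linear_step h (1 / (2 * \<eta>)) R
   = arg_min (\<lambda>R'. h (R ** transpose R + sym_prod R (R' - R)) + \<eta> * (norm (R' - R))\<^sup>2) (\<lambda>_. True)"
  by (simp add: prox_linear_step_def sym_prod_def add.assoc)

lemma convex_on_linearized:
  assumes "convex_on sym_mats h"
  shows "convex_on UNIV (\<lambda>R'. h (R ** transpose R + sym_prod R (R' - R)))"
proof (rule convex_onI)
  fix t :: real and U V assume t: "0 < t" "t < 1"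
  let ?l = "\<lambda>R'. R ** transpose R + sym_prod R (R' - R)"
  have "?l ((1 - t) *\<^sub>R U + t *\<^sub>R V) = (1 - t) *\<^sub>R ?l U + t *\<^sub>R ?l V"
    by (simp add: sym_prod_diff sym_prod_add sym_prod_scaleR algebra_simps)
  moreover have "?l W \<in> sym_mats" for W
    by (intro sym_mats_add gram_in_sym_mats sym_prod_in_sym_mats)
  ultimately show "h (?l ((1 - t) *\<^sub>R U + t *\<^sub>R V)) \<le> (1 - t) * h (?l U) + t * h (?l V)"
    using t convex_onD[OF assms, of t "?l U" "?l V"] by simp
qed simp

section \<open>Linear convergence of the prox-linear algorithm\<close>

text \<open>The stepsize \<open>1 / (2 \<eta>)\<close> must not degenerate. For \<open>\<eta> = 0\<close> the function \<open>h\<close> would be constant near \<open>X\<close>,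
  and by quadratic growth \<open>S\<close> would contain a neighbourhood of itself; but all factors have the same
  norm.\<close>

lemma growth_imp_lipschitz_pos:
  fixes S :: "(real^'r^'n) set"
  assumes S: "S = factors X" "S \<noteq> {}"
    and lip: "\<eta>-lipschitz_on (ball X \<delta>0 \<inter> sym_mats) h" "0 < \<delta>0"
    and growth: "quadratic_growth (\<lambda>R. h (R ** transpose R)) (h X) S \<alpha>" "0 < \<alpha>"
  shows "0 < \<eta>"
proof (rule ccontr)
  assume "\<not> 0 < \<eta>"
  with lipschitz_on_nonneg[OF lip(1)] have "\<eta> = 0" by simp
  obtain \<delta>g where \<delta>g: "0 < \<delta>g"
      "\<And>R. R \<in> nbhd S \<delta>g \<Longrightarrow> h X + \<alpha> / 2 * (infdist R S)\<^sup>2 \<le> h (R ** transpose R)"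
    using growth(1) by (auto simp: quadratic_growth_def)
  obtain T where T: "T \<in> S"
    using S by blast
  define B where "B = 2 * norm T + 1"
  have B: "1 \<le> B"
    by (simp add: B_def)
  define \<tau> where "\<tau> = Min {1, \<delta>g, \<delta>0 / B} / 2"
  have \<tau>: "0 < \<tau>" "\<tau> < 1" "\<tau> < \<delta>g" "\<tau> * B < \<delta>0"
  proof -
    have "0 < Min {1, \<delta>g, \<delta>0 / B}"
      using B \<delta>g lip(2) by simp
    then have "0 < \<tau>" "2 * \<tau> \<le> 1" "2 * \<tau> \<le> \<delta>g" "2 * \<tau> \<le> \<delta>0 / B"
      by (simp_all add: \<tau>_def)
    then show "0 < \<tau>" "\<tau> < 1" "\<tau> < \<delta>g" "\<tau> * B < \<delta>0"
    proof -
      have "0 < \<tau> * B"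
        using \<open>0 < \<tau>\<close> B by simp
      moreover have "2 * (\<tau> * B) \<le> \<delta>0"
        using \<open>2 * \<tau> \<le> \<delta>0 / B\<close> B by (simp add: pos_le_divide_eq)
      ultimately show "\<tau> * B < \<delta>0"
        by linarith
    qed linarith+
  qed
  \<comment> \<open>All factors have the same norm, so moving radially by \<open>\<tau>\<close> leaves \<open>S\<close>.\<close>
  obtain R :: "real^'r^'n" where R: "norm (R - T) = \<tau>" "norm R = norm T + \<tau>"
  proof (cases "T = 0")
    case True
    obtain U :: "real^'r^'n" where "norm U = \<tau>"
      using vector_choose_size[of \<tau>] \<tau> by auto
    then show thesis
      using that[of U] True by simp
  next
    case False
    have "T + (\<tau> / norm T) *\<^sub>R T = ((norm T + \<tau>) / norm T) *\<^sub>R T"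
      using False by (simp add: add_divide_distrib scaleR_add_left)
    then have "norm (T + (\<tau> / norm T) *\<^sub>R T) = norm T + \<tau>"
      using False \<tau> by simp
    then show thesis
      using that[of "T + (\<tau> / norm T) *\<^sub>R T"] False \<tau> by simp
  qed
  have dist: "infdist R S \<le> \<tau>"
    using infdist_le[OF T, of R] R by (simp add: dist_norm)
  have "norm (R ** transpose R - X) \<le> B * infdist R S"
    using gram_dist_le[of T X R] T S dist \<tau> by (simp add: B_def)
  also have "\<dots> \<le> \<tau> * B"
    using dist B by (simp add: mult.commute)
  finally have "R ** transpose R \<in> ball X \<delta>0 \<inter> sym_mats"
    using \<tau> by (simp add: gram_in_sym_mats dist_norm norm_minus_commute)
  moreover have "X \<in> ball X \<delta>0 \<inter> sym_mats"
    using T S gram_in_sym_mats[of T] lip(2) by (auto simp: factors_def)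
  ultimately have "h (R ** transpose R) = h X"
    using lipschitz_onD[OF lip(1), of "R ** transpose R" X] \<open>\<eta> = 0\<close> by simp
  moreover have "R \<in> nbhd S \<delta>g"
    using dist \<tau> by (simp add: nbhd_def)
  ultimately have "\<alpha> / 2 * (infdist R S)\<^sup>2 \<le> 0"
    using \<delta>g(2)[of R] by simp
  then have "infdist R S = 0"
    using growth(2) by (simp add: mult_le_0_iff)
  then have "R \<in> S"
    using in_closed_iff_infdist_zero[OF closed_factors] S by blast
  then have "norm R = norm T"
    using norm_factors_eq T S by blast
  with R \<tau> show False
    by simp
qed

text \<open>One step, with the model minimizer compared to the point \<open>R + s V\<close>. Convexity of \<open>h\<close> bounds
  the model there by \<open>(1 - s) h (R R\<^sup>T) + s h (R R\<^sup>T + sym_prod R V)\<close> plus the proximal term of order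
  \<open>s\<^sup>2 \<eta> d\<^sup>2\<close>; the choice of \<open>s\<close> balances the gain against the latter. The excess \<open>\<alpha> / 8 * d\<^sup>2\<close> in
  the assumption is at most a quarter of the gap.\<close>

lemma model_decrease:
  fixes R V :: "real^'r^'n"
  assumes h: "convex_on sym_mats h" and pos: "0 < \<eta>" "0 < \<alpha>"
    and V: "norm V \<le> 2 * d" "h (R ** transpose R + sym_prod R V) \<le> hs + \<alpha> / 8 * d\<^sup>2"
    and growth: "hs + \<alpha> / 2 * d\<^sup>2 \<le> h (R ** transpose R)"
  shows "\<exists>R'. h (R ** transpose R + sym_prod R (R' - R)) + \<eta> * (norm (R' - R))\<^sup>2 - hs
      \<le> (1 - 1 / (4 + 64 * \<eta> / \<alpha>)) * (h (R ** transpose R) - hs)"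
proof -
  define s where "s = \<alpha> / (\<alpha> + 16 * \<eta>)"
  define gap where "gap = h (R ** transpose R) - hs"
  have s: "0 < s" "s \<le> 1" "s * (\<alpha> + 16 * \<eta>) = \<alpha>"
    using pos by (auto simp: s_def)
  have gap: "\<alpha> * d\<^sup>2 \<le> 2 * gap"
    using growth by (simp add: gap_def)
  have "R ** transpose R + s *\<^sub>R sym_prod R V
      = (1 - s) *\<^sub>R (R ** transpose R) + s *\<^sub>R (R ** transpose R + sym_prod R V)"
    by (simp add: algebra_simps)
  then have "h (R ** transpose R + s *\<^sub>R sym_prod R V)
      \<le> (1 - s) * h (R ** transpose R) + s * h (R ** transpose R + sym_prod R V)"
    using convex_onD[OF h, of s "R ** transpose R" "R ** transpose R + sym_prod R V"] s
    by (simp add: gram_in_sym_mats sym_mats_add sym_prod_in_sym_mats)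
  also have "\<dots> \<le> (1 - s) * h (R ** transpose R) + s * (hs + \<alpha> / 8 * d\<^sup>2)"
    using V(2) s by simp
  finally have 1: "h (R ** transpose R + s *\<^sub>R sym_prod R V) - hs \<le> (1 - s) * gap + s * (\<alpha> * d\<^sup>2) / 8"
    by (simp add: gap_def algebra_simps)
  have "(norm V)\<^sup>2 \<le> 4 * d\<^sup>2"
    using power_mono[OF V(1) norm_ge_zero, of 2] by (simp add: power_mult_distrib)
  then have "\<eta> * (s\<^sup>2 * (norm V)\<^sup>2) \<le> \<eta> * (s\<^sup>2 * (4 * d\<^sup>2))"
    using pos by (intro mult_left_mono) auto
  also have "\<dots> = (16 * \<eta> * s) * s * d\<^sup>2 / 4"
    by (simp add: power2_eq_square)
  also have "\<dots> \<le> \<alpha> * s * d\<^sup>2 / 4"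
  proof -
    have "16 * \<eta> * s \<le> \<alpha>"
      using mult_pos_pos[OF s(1) pos(2)] s(3) by (simp add: algebra_simps)
    then show ?thesis
      using s by (intro divide_right_mono mult_right_mono) auto
  qed
  finally have 2: "\<eta> * (s\<^sup>2 * (norm V)\<^sup>2) \<le> s * (\<alpha> * d\<^sup>2) / 4"
    by (simp add: mult_ac)
  have "h (R ** transpose R + s *\<^sub>R sym_prod R V) + \<eta> * (s\<^sup>2 * (norm V)\<^sup>2) - hs
      \<le> (1 - s) * gap + 3 / 8 * s * (\<alpha> * d\<^sup>2)"
    using 1 2 by simp
  also have "\<dots> \<le> (1 - s) * gap + 3 / 8 * s * (2 * gap)"
    using gap s by (intro add_left_mono mult_left_mono) auto
  also have "\<dots> = (1 - s / 4) * gap"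
    by (simp add: algebra_simps)
  also have "s / 4 = 1 / (4 + 64 * \<eta> / \<alpha>)"
    using pos by (simp add: s_def field_simps)
  finally show ?thesis
    by (intro exI[of _ "R + s *\<^sub>R V"]) (simp add: sym_prod_scaleR power_mult_distrib gap_def)
qed

text \<open>Near \<open>S\<close> the model majorizes \<open>h (R R\<^sup>T)\<close>, so it is bounded below by \<open>h X\<close>, while its value at the
  current point tends to \<open>h X\<close> as that point approaches \<open>S\<close>. This localizes the proximal point, and
  the model decrease along the assumed direction carries over to the objective.\<close>

lemma prox_linear_linear_rate:
  fixes S :: "(real^'r^'n) set" and h :: "real^'n^'n \<Rightarrow> real"
  assumes S: "S = factors X" "S \<noteq> {}"
    and h: "convex_on sym_mats h"
    and lip: "\<eta>-lipschitz_on (ball X \<delta>0 \<inter> sym_mats) h" "0 < \<delta>0"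
    and growth: "quadratic_growth (\<lambda>R. h (R ** transpose R)) (h X) S \<alpha>" "0 < \<alpha>"
    and direction: "\<And>\<kappa>. 0 < \<kappa> \<Longrightarrow> \<exists>\<delta>>0. \<forall>R\<in>nbhd S \<delta>. \<exists>V. norm V \<le> 2 * infdist R S \<and>
      h (R ** transpose R + sym_prod R V) \<le> h X + \<kappa> * (infdist R S)\<^sup>2"
  defines "R \<equiv> prox_linear h (1 / (2 * \<eta>))"
  shows "\<exists>\<delta>>0. \<forall>R0\<in>nbhd S \<delta>. \<forall>j. h X \<le> h (R R0 j ** transpose (R R0 j)) \<and>
    h (R R0 (Suc j) ** transpose (R R0 (Suc j))) - h X
      \<le> (1 - 1 / (4 + 64 * \<eta> / \<alpha>)) * (h (R R0 j ** transpose (R R0 j)) - h X)"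
proof -
  let ?\<phi> = "\<lambda>R. h (R ** transpose R)"
  have \<eta>: "0 < \<eta>"
    using growth_imp_lipschitz_pos[OF S lip growth] .
  have \<alpha>: "0 < \<alpha>" by fact
  obtain \<delta>g where \<delta>g: "0 < \<delta>g"
      "\<And>R. R \<in> nbhd S \<delta>g \<Longrightarrow> h X + \<alpha> / 2 * (infdist R S)\<^sup>2 \<le> ?\<phi> R"
    using growth(1) by (auto simp: quadratic_growth_def)
  have "0 < \<alpha> / 8"
    using \<alpha> by simp
  from direction[OF this] obtain \<delta>V where \<delta>V: "0 < \<delta>V"
      "\<And>R. R \<in> nbhd S \<delta>V \<Longrightarrow> \<exists>V. norm V \<le> 2 * infdist R S \<and>
        h (R ** transpose R + sym_prod R V) \<le> h X + \<alpha> / 8 * (infdist R S)\<^sup>2"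
    by blast
  obtain T where T: "T \<in> S"
    using S by blast
  define B where "B = 2 * norm T + 1"
  have B: "1 \<le> B" "2 * norm T + 1 = B"
    by (auto simp: B_def)
  have X: "X \<in> ball X \<delta>0 \<inter> sym_mats"
    using T S gram_in_sym_mats[of T] lip(2) by (auto simp: factors_def)
  have lipD: "\<bar>h U - h V\<bar> \<le> \<eta> * norm (U - V)"
    if "U \<in> ball X \<delta>0 \<inter> sym_mats" "V \<in> ball X \<delta>0 \<inter> sym_mats" for U V
    using lipschitz_onD[OF lip(1) that] by (simp add: dist_norm)

  \<comment> \<open>Within distance \<open>\<rho>\<close> of a point of the tube \<open>nbhd S \<rho>\<close>, the growth condition holds, and \<open>R R\<^sup>T\<close>
    and its linearization stay in the ball on which \<open>h\<close> is Lipschitz.\<close>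
  define \<rho> where "\<rho> = Min {1/2, \<delta>g / 2, \<delta>0 / (4 * B)}"
  have \<rho>: "0 < \<rho>" "\<rho> \<le> 1/2" "2 * \<rho> \<le> \<delta>g" "\<rho> * (4 * B) \<le> \<delta>0"
  proof -
    show "0 < \<rho>"
      using \<delta>g lip(2) B by (simp add: \<rho>_def)
    have "\<rho> \<le> \<delta>g / 2" "\<rho> \<le> \<delta>0 / (4 * B)" "\<rho> \<le> 1/2"
      by (simp_all add: \<rho>_def)
    then show "\<rho> \<le> 1/2" "2 * \<rho> \<le> \<delta>g" "\<rho> * (4 * B) \<le> \<delta>0"
      using B by (simp_all add: pos_le_divide_eq)
  qed
  have "0 \<le> B * \<rho>"
    using B \<rho> by simp
  have infdist_near: "infdist U S \<le> infdist W S + norm (U - W)" for U W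
    using infdist_triangle[of U S W] by (simp add: dist_norm)
  have gram_near: "norm (U ** transpose U - X) \<le> B * infdist U S" if "infdist U S \<le> 1" for U
    using gram_dist_le[of T X U] T S that B by simp
  have gram_ball: "U ** transpose U \<in> ball X \<delta>0 \<inter> sym_mats" if "infdist U S < 2 * \<rho>" for U
  proof -
    have "norm (U ** transpose U - X) \<le> B * infdist U S"
      using that \<rho> by (intro gram_near) simp
    also have "\<dots> < B * (2 * \<rho>)"
      using that B by (intro mult_strict_left_mono) auto
    also have "\<dots> \<le> \<delta>0"
      using \<open>0 \<le> B * \<rho>\<close> \<rho>(4) by (simp add: mult.commute mult.left_commute)
    finally show ?thesis
      by (simp add: gram_in_sym_mats dist_norm norm_minus_commute)
  qed
  have lin_ball: "W ** transpose W + sym_prod W (U - W) \<in> ball X \<delta>0 \<inter> sym_mats"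
    if W: "infdist W S < \<rho>" and U: "norm (U - W) \<le> \<rho>" for W U
  proof -
    obtain T' where T': "T' \<in> factors X" "infdist W S = norm (W - T')"
      using nearest_factor[of X W] S by auto
    have "norm W \<le> norm T' + norm (W - T')"
      using norm_triangle_ineq[of T' "W - T'"] by simp
    then have "2 * norm W \<le> B + 1"
      using norm_factors_eq[OF T'(1), of T] T S T'(2) W \<rho> B by simp
    then have "2 * norm W * norm (U - W) \<le> (2 * B) * \<rho>"
      using U B \<rho> by (intro mult_mono) auto
    then have "norm (sym_prod W (U - W)) \<le> (2 * B) * \<rho>"
      using norm_sym_prod_le[of W "U - W"] by linarith
    moreover have "norm (W ** transpose W - X) < B * \<rho>"
    proof -
      have "norm (W ** transpose W - X) \<le> B * infdist W S"
        using W \<rho> by (intro gram_near) simp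
      also have "\<dots> < B * \<rho>"
        using W B by (intro mult_strict_left_mono) auto
      finally show ?thesis .
    qed
    moreover have "W ** transpose W + sym_prod W (U - W) - X
        = (W ** transpose W - X) + sym_prod W (U - W)"
      by simp
    ultimately have "norm (W ** transpose W + sym_prod W (U - W) - X) < B * \<rho> + 2 * B * \<rho>"
      by (metis add_less_le_mono norm_triangle_ineq order_le_less_trans)
    also have "\<dots> \<le> \<delta>0"
      using \<open>0 \<le> B * \<rho>\<close> \<rho>(4) by (simp add: mult.commute mult.left_commute)
    finally show ?thesis
      by (simp add: gram_in_sym_mats sym_mats_add sym_prod_in_sym_mats dist_norm norm_minus_commute)
  qed
  have model_upper: "?\<phi> U \<le> h (W ** transpose W + sym_prod W (U - W)) + \<eta> * (norm (U - W))\<^sup>2"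
    if W: "infdist W S < \<rho>" and U: "norm (U - W) \<le> \<rho>" for W U
  proof -
    have "U ** transpose U - (W ** transpose W + sym_prod W (U - W))
        = (U - W) ** transpose (U - W)"
      using gram_add[of W "U - W"] by simp
    moreover have "U ** transpose U \<in> ball X \<delta>0 \<inter> sym_mats"
      using infdist_near[of U W] W U by (intro gram_ball) simp
    ultimately have "\<bar>?\<phi> U - h (W ** transpose W + sym_prod W (U - W))\<bar>
        \<le> \<eta> * norm ((U - W) ** transpose (U - W))"
      using lipD[OF _ lin_ball[OF W U], of "U ** transpose U"] by simp
    also have "\<dots> \<le> \<eta> * (norm (U - W))\<^sup>2"
      using \<eta> norm_gram_le[of "U - W"] by simp
    finally show ?thesis
      by simp
  qed
  have growth_near: "h X + \<alpha> / 2 * (infdist U S)\<^sup>2 \<le> ?\<phi> U" if "infdist U S < 2 * \<rho>" for U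
    using that \<rho> by (intro \<delta>g(2)) (simp add: nbhd_def)
  have gap_upper: "?\<phi> U - h X \<le> \<eta> * (B * infdist U S)" if "infdist U S < 2 * \<rho>" for U
  proof -
    have "?\<phi> U - h X \<le> \<eta> * norm (U ** transpose U - X)"
      using lipD[OF gram_ball[OF that] X] by simp
    also have "\<dots> \<le> \<eta> * (B * infdist U S)"
      using that \<rho> \<eta> by (intro mult_left_mono gram_near) auto
    finally show ?thesis .
  qed

  define q where "q = 1 - 1 / (4 + 64 * \<eta> / \<alpha>)"
  have q: "q \<le> 1"
    using \<eta> \<alpha> by (simp add: q_def)
  define \<delta>1 where "\<delta>1 = Min {\<rho>, \<delta>V, \<rho>\<^sup>2 / (2 * B)}"
  have \<delta>1: "0 < \<delta>1" "\<delta>1 \<le> \<rho>" "\<delta>1 \<le> \<delta>V" "\<delta>1 \<le> \<rho>\<^sup>2 / (2 * B)"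
  proof -
    show "0 < \<delta>1"
      using \<rho> \<delta>V(1) B by (simp add: \<delta>1_def)
  qed (simp_all add: \<delta>1_def)

  have step: "infdist (prox_linear_step h (1 / (2 * \<eta>)) W) S < 2 * \<rho> \<and>
      ?\<phi> (prox_linear_step h (1 / (2 * \<eta>)) W) - h X \<le> q * (?\<phi> W - h X)"
    if W1: "infdist W S < \<delta>1" for W
  proof -
    define P where "P = prox_linear_step h (1 / (2 * \<eta>)) W"
    have W: "infdist W S < \<rho>"
      using W1 \<delta>1 by simp
    have lower: "h X \<le> h (W ** transpose W + sym_prod W (U - W)) + \<eta> * (norm (U - W))\<^sup>2"
      if U: "norm (U - W) \<le> \<rho>" for U
    proof -
      have "h X \<le> h X + \<alpha> / 2 * (infdist U S)\<^sup>2"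
        using \<alpha> by simp
      also have "\<dots> \<le> ?\<phi> U"
        using infdist_near[of U W] W U by (intro growth_near) simp
      finally show ?thesis
        using model_upper[OF W U] by simp
    qed
    have "?\<phi> W - h X \<le> \<eta> * (B * infdist W S)"
      using W \<rho>(1) by (intro gap_upper) simp
    also have "\<dots> < \<eta> * (B * (\<rho>\<^sup>2 / (2 * B)))"
      using W1 \<delta>1 \<eta> B by (intro mult_strict_left_mono) auto
    finally have "2 * (h (W ** transpose W + sym_prod W (W - W)) - h X) < \<eta> * \<rho>\<^sup>2"
      using B by (simp add: field_simps)
    note prox = prox_point_localized[OF convex_on_linearized[OF h] \<eta> \<rho>(1) lower this,
        folded prox_linear_step_alt, folded P_def]
    have P: "infdist P S < 2 * \<rho>"
      using infdist_near[of P W] W prox(1) by simp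
    obtain V where V: "norm V \<le> 2 * infdist W S"
        "h (W ** transpose W + sym_prod W V) \<le> h X + \<alpha> / 8 * (infdist W S)\<^sup>2"
      using \<delta>V(2)[of W] W1 \<delta>1 by (auto simp: nbhd_def)
    have "h X + \<alpha> / 2 * (infdist W S)\<^sup>2 \<le> ?\<phi> W"
      using W \<rho>(1) by (intro growth_near) simp
    from model_decrease[OF h \<eta> \<alpha> V this] obtain R' where
      "h (W ** transpose W + sym_prod W (R' - W)) + \<eta> * (norm (R' - W))\<^sup>2 - h X \<le> q * (?\<phi> W - h X)"
      by (auto simp: q_def)
    with prox(2)[of R'] model_upper[OF W, of P] prox(1)
    have "?\<phi> P - h X \<le> q * (?\<phi> W - h X)"
      by simp
    with P show ?thesis
      by (simp add: P_def)
  qed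

  define \<delta> where "\<delta> = min \<delta>1 (\<alpha> * \<delta>1\<^sup>2 / (4 * \<eta> * B))"
  have \<delta>: "0 < \<delta>" "\<delta> \<le> \<delta>1" "\<delta> \<le> \<alpha> * \<delta>1\<^sup>2 / (4 * \<eta> * B)"
    using \<delta>1 \<alpha> \<eta> B by (simp_all add: \<delta>_def)
  \<comment> \<open>The gap does not increase and bounds the squared distance to \<open>S\<close>, so no iterate leaves
    the tube.\<close>
  have invariant: "infdist (R R0 j) S < \<delta>1 \<and> ?\<phi> (R R0 j) - h X < \<alpha> / 2 * \<delta>1\<^sup>2"
    if R0: "R0 \<in> nbhd S \<delta>" for R0 j
  proof (induction j)
    case 0
    have d: "infdist R0 S < \<delta>"
      using R0 by (simp add: nbhd_def)
    have "?\<phi> R0 - h X \<le> \<eta> * (B * infdist R0 S)"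
      using d \<delta> \<delta>1 \<rho>(1) by (intro gap_upper) simp
    also have "\<dots> < \<eta> * (B * (\<alpha> * \<delta>1\<^sup>2 / (4 * \<eta> * B)))"
      using d \<delta> \<eta> B by (intro mult_strict_left_mono) auto
    also have "\<dots> \<le> \<alpha> / 2 * \<delta>1\<^sup>2"
      using \<eta> B \<alpha> by (simp add: field_simps)
    finally show ?case
      using d \<delta> by (simp add: R_def prox_linear_def)
  next
    case (Suc j)
    let ?W = "R R0 j" and ?P = "R R0 (Suc j)"
    have P: "?P = prox_linear_step h (1 / (2 * \<eta>)) ?W"
      by (simp add: R_def prox_linear_def)
    have *: "infdist ?P S < 2 * \<rho>" "?\<phi> ?P - h X \<le> q * (?\<phi> ?W - h X)"
      using step[of ?W] Suc P by auto
    have "0 \<le> ?\<phi> ?W - h X"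
    proof -
      have "h X \<le> h X + \<alpha> / 2 * (infdist ?W S)\<^sup>2"
        using \<alpha> by simp
      also have "\<dots> \<le> ?\<phi> ?W"
        using Suc \<delta>1 \<rho>(1) by (intro growth_near) simp
      finally show ?thesis
        by simp
    qed
    with q have "q * (?\<phi> ?W - h X) \<le> 1 * (?\<phi> ?W - h X)"
      by (intro mult_right_mono) auto
    with * Suc have gap: "?\<phi> ?P - h X < \<alpha> / 2 * \<delta>1\<^sup>2"
      by simp
    then have "\<alpha> / 2 * (infdist ?P S)\<^sup>2 < \<alpha> / 2 * \<delta>1\<^sup>2"
      using growth_near[OF *(1)] by simp
    then have "(infdist ?P S)\<^sup>2 < \<delta>1\<^sup>2"
      using \<alpha> by simp
    then have "infdist ?P S < \<delta>1"
      using \<delta>1(1) power2_less_imp_less by (metis less_imp_le)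
    with gap show ?case
      by simp
  qed
  show ?thesis
  proof (intro exI[of _ \<delta>] conjI ballI allI)
    fix R0 j assume R0: "R0 \<in> nbhd S \<delta>"
    have d: "infdist (R R0 j) S < \<delta>1"
      using invariant[OF R0] by simp
    have "h X \<le> h X + \<alpha> / 2 * (infdist (R R0 j) S)\<^sup>2"
      using \<alpha> by simp
    also have "\<dots> \<le> ?\<phi> (R R0 j)"
      using d \<delta>1 \<rho>(1) by (intro growth_near) simp
    finally show "h X \<le> ?\<phi> (R R0 j)" .
    show "?\<phi> (R R0 (Suc j)) - h X \<le> (1 - 1 / (4 + 64 * \<eta> / \<alpha>)) * (?\<phi> (R R0 j) - h X)"
      using step[OF d] by (simp add: R_def prox_linear_def q_def)
  qed (rule \<delta>(1))
qed


section \<open>The penalty threshold\<close>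

lemma has_sym_gradient_along:
  assumes "has_sym_gradient f G X" "X \<in> sym_mats" "D \<in> sym_mats"
  shows "((\<lambda>t. f (X + t *\<^sub>R D)) has_derivative (\<lambda>t. t * (G \<bullet> D))) (at 0)"
proof -
  let ?l = "\<lambda>t. X + t *\<^sub>R D"
  have "(?l has_derivative (\<lambda>t. t *\<^sub>R D)) (at 0)"
    by (auto intro!: derivative_eq_intros)
  moreover have "range ?l \<subseteq> sym_mats"
    using assms(2,3) by (auto intro: sym_mats_add sym_mats_scale)
  then have "(f has_derivative (\<lambda>H. G \<bullet> H)) (at (?l 0) within range ?l)"
    using assms(1) has_derivative_subset by (auto simp: has_sym_gradient_def)
  ultimately show ?thesis
    using has_derivative_in_compose[of ?l "\<lambda>t. t *\<^sub>R D" 0 UNIV f "\<lambda>H. G \<bullet> H"] by simp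
qed

lemma has_sym_gradient_unique:
  assumes "has_sym_gradient f G X" "has_sym_gradient f G' X" "X \<in> sym_mats"
  shows "G = G'"
proof -
  have D: "G - G' \<in> sym_mats"
    using assms by (auto simp: has_sym_gradient_def intro: sym_mats_diff)
  have "(\<lambda>t. t * (G \<bullet> (G - G'))) = (\<lambda>t. t * (G' \<bullet> (G - G')))"
    by (rule has_derivative_unique[OF has_sym_gradient_along[OF assms(1,3) D]
          has_sym_gradient_along[OF assms(2,3) D]])
  from fun_cong[OF this, of 1] have "(G - G') \<bullet> (G - G') = 0"
    by (simp add: inner_diff_left)
  then show ?thesis
    by simp
qed

lemma phi_f_has_derivative:
  fixes R :: "real^'r^'n"
  assumes "has_sym_gradient f G (R ** transpose R)"
  shows "(phi_f f has_derivative (\<lambda>H. (2 *\<^sub>R (G ** R)) \<bullet> H)) (at R)"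
proof -
  have "range (\<lambda>R :: real^'r^'n. R ** transpose R) \<subseteq> sym_mats"
    using gram_in_sym_mats by blast
  then have "(f has_derivative (\<lambda>H. G \<bullet> H))
      (at (R ** transpose R) within range (\<lambda>R :: real^'r^'n. R ** transpose R))"
    using assms has_derivative_subset by (auto simp: has_sym_gradient_def)
  from has_derivative_in_compose[OF gram_has_derivative this]
  have "((\<lambda>R :: real^'r^'n. f (R ** transpose R)) has_derivative (\<lambda>H. G \<bullet> sym_prod R H)) (at R)" .
  moreover have "(\<lambda>H. G \<bullet> sym_prod R H) = (\<lambda>H. (2 *\<^sub>R (G ** R)) \<bullet> H)"
    using assms by (simp add: inner_sym_prod has_sym_gradient_def)
  ultimately show ?thesis
    by (simp add: phi_f_def[abs_def])
qed

lemma grad_phi_f: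
  assumes "has_sym_gradient f G (R ** transpose R)"
  shows "grad (phi_f f) R = 2 *\<^sub>R (G ** R)"
  unfolding grad_def gderiv_def
proof (rule the_equality)
  show "(phi_f f has_derivative (\<lambda>h. h \<bullet> (2 *\<^sub>R (G ** R)))) (at R)"
    using phi_f_has_derivative[OF assms] by (simp only: inner_commute)
next
  fix D assume "(phi_f f has_derivative (\<lambda>h. h \<bullet> D)) (at R)"
  from has_derivative_unique[OF this phi_f_has_derivative[OF assms]]
  have "h \<bullet> D = h \<bullet> (2 *\<^sub>R (G ** R))" for h
    by (simp only: inner_commute[of h "2 *\<^sub>R (G ** R)"]) metis
  then show "D = 2 *\<^sub>R (G ** R)"
    by (rule vector_eq_ldot[THEN iffD1, rule_format])
qed

lemma dual_optimum_gradient_mul_factor: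
  fixes R :: "real^'r^'n"
  assumes "dual_optimum f A X y Z" "has_sym_gradient f G X" "R \<in> factors X"
  shows "G ** R = - (\<Sum>i\<in>UNIV. y $ i *\<^sub>R (A i ** R))"
proof -
  have R: "R ** transpose R = X"
    using assms(3) by (simp add: factors_def)
  then have X: "X \<in> sym_mats"
    using gram_in_sym_mats by metis
  from assms(1) obtain G' where Z: "psd Z" "Z \<bullet> X = 0" and G': "has_sym_gradient f G' X"
    and GZ: "G' + (\<Sum>i\<in>UNIV. y $ i *\<^sub>R A i) - Z = 0"
    by (auto simp: dual_optimum_def)
  have "G = G'"
    using has_sym_gradient_unique[OF assms(2) G' X] .
  then have "G = Z - (\<Sum>i\<in>UNIV. y $ i *\<^sub>R A i)"
    using GZ by (simp add: algebra_simps)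
  moreover have "Z ** R = 0"
    using psd_annihilates_factor[OF Z(1), of R] Z(2) R by simp
  ultimately show ?thesis
    by (simp add: matmul.diff_left matmul.sum_left matmul.scaleR_left)
qed

text \<open>At a factor of \<open>X\<close> the dual optimum makes the least-squares residual that defines the
  multiplier vanish, and injectivity of \<open>M_mat A R\<close> makes it the only minimizer.\<close>

lemma multiplier_eq_dual:
  fixes R :: "real^'r^'n" and A :: "'k::finite \<Rightarrow> real^'n^'n"
  assumes dual: "dual_optimum f A X y Z" and G: "has_sym_gradient f G X" and R: "R \<in> factors X"
    and "0 < \<gamma>" and cq: "\<And>z. \<gamma> * norm z \<le> norm (M_mat A R *v z)"
  shows "multiplier f A R = y"
proof -
  have "grad (phi_f f) R = 2 *\<^sub>R (G ** R)"
    using grad_phi_f[of f G R] G R by (simp add: factors_def)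
  also have "\<dots> = - 2 *\<^sub>R (\<Sum>i\<in>UNIV. y $ i *\<^sub>R (A i ** R))"
    using dual_optimum_gradient_mul_factor[OF dual G R] by simp
  finally have "norm (grad (phi_f f) R + 2 *\<^sub>R (\<Sum>i\<in>UNIV. z $ i *\<^sub>R (A i ** R)))
      = 2 * norm (M_mat A R *v (z - y))" for z
    unfolding norm_M_mat_mult_vec
    by (simp add: scaleR_diff_left sum_subtractf scaleR_diff_right[symmetric])
  then have m: "multiplier f A R = arg_min (\<lambda>z. 2 * norm (M_mat A R *v (z - y))) (\<lambda>_. True)"
    by (simp add: multiplier_def)
  have "is_arg_min (\<lambda>z. 2 * norm (M_mat A R *v (z - y))) (\<lambda>_. True) z \<longleftrightarrow> z = y" for z
  proof
    assume "is_arg_min (\<lambda>z. 2 * norm (M_mat A R *v (z - y))) (\<lambda>_. True) z"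
    then have "norm (M_mat A R *v (z - y)) \<le> norm (M_mat A R *v (y - y))"
      unfolding is_arg_min_linorder by (metis mult_le_cancel_left_pos zero_less_numeral)
    then have "\<gamma> * norm (z - y) \<le> 0"
      using cq[of "z - y"] by simp
    with \<open>0 < \<gamma>\<close> show "z = y"
      by (simp add: mult_le_0_iff)
  qed (simp add: is_arg_min_linorder)
  then show ?thesis
    by (simp add: m arg_min_def)
qed

text \<open>With \<open>B = \<Sum>\<^sub>i z\<^sub>i A\<^sub>i\<close> one has \<open>\<parallel>M z\<parallel>\<^sup>2 = \<parallel>B R\<parallel>\<^sup>2 = \<langle>B, B R R\<^sup>T\<rangle>\<close>, which depends on \<open>R\<close> only through
  \<open>R R\<^sup>T\<close>.\<close>

lemma norm_M_mat_factors_eq: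
  fixes R T :: "real^'r^'n" and A :: "'k::finite \<Rightarrow> real^'n^'n"
  assumes "R \<in> factors X" "T \<in> factors X"
  shows "norm (M_mat A R *v z) = norm (M_mat A T *v z)"
proof -
  let ?B = "\<Sum>i\<in>UNIV. z $ i *\<^sub>R A i"
  have eq: "(\<Sum>i\<in>UNIV. z $ i *\<^sub>R (A i ** U)) = ?B ** U" for U :: "real^'r^'n"
    by (simp add: matmul.sum_left matmul.scaleR_left)
  have "(?B ** U) \<bullet> (?B ** U) = ?B \<bullet> (?B ** X)" if "U \<in> factors X" for U :: "real^'r^'n"
    using that unfolding inner_matrix_mul_left factors_def
    by (simp add: matrix_mul_assoc[symmetric])
  from this[OF assms(1)] this[OF assms(2)] show ?thesis
    unfolding norm_M_mat_mult_vec eq by (simp only: norm_eq_sqrt_inner)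
qed

text \<open>The tube around \<open>S\<close> is not convex. Points at distance less than \<open>\<rho>\<close> are joined by a segment
  inside a larger tube, on which the gradient bound applies; for points further apart it suffices
  that both values of \<open>phi_f f\<close> differ from \<open>f X\<close> by at most \<open>\<tau> \<epsilon>\<close>, with \<open>\<epsilon>\<close> small compared with
  \<open>\<rho>\<close>.\<close>

lemma phi_f_lipschitz_on_tube:
  fixes S :: "(real^'r^'n) set"
  assumes S: "S = factors X" "S \<noteq> {}"
    and G: "\<And>Y. Y \<in> sym_mats \<Longrightarrow> has_sym_gradient f (G Y) Y"
    and cont: "continuous (at X within sym_mats) G"
    and bound: "\<And>T. T \<in> S \<Longrightarrow> norm (2 *\<^sub>R (G X ** T)) \<le> \<beta>" and "\<beta> < \<tau>"
  shows "\<exists>\<epsilon>\<^sub>0>0. \<forall>\<epsilon>. 0 < \<epsilon> \<longrightarrow> \<epsilon> < \<epsilon>\<^sub>0 \<longrightarrow> \<tau>-lipschitz_on (nbhd S \<epsilon>) (phi_f f)"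
proof -
  obtain T0 where T0: "T0 \<in> S"
    using S by blast
  define B where "B = 2 * norm T0 + 1"
  have B: "1 \<le> B" "norm T0 + 1 \<le> B"
    by (auto simp: B_def)
  have "0 \<le> \<beta>"
    using bound[OF T0] norm_ge_zero order_trans by blast
  with \<open>\<beta> < \<tau>\<close> have \<tau>: "0 < \<tau>" by simp
  \<comment> \<open>\<open>e\<close> and \<open>\<rho>\<close> allot one half of \<open>\<tau> - \<beta>\<close> to the variation of \<open>G\<close> and one half to that of \<open>R\<close>.\<close>
  define e where "e = (\<tau> - \<beta>) / (4 * B)"
  have e: "0 < e" "4 * B * e = \<tau> - \<beta>"
    using \<open>\<beta> < \<tau>\<close> B by (auto simp: e_def)
  from cont e(1) obtain \<delta> where \<delta>: "0 < \<delta>"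
    "\<And>Y. Y \<in> sym_mats \<Longrightarrow> norm (Y - X) < \<delta> \<Longrightarrow> norm (G Y - G X) < e"
    unfolding continuous_within_eps_delta dist_norm by meson
  define \<rho> where "\<rho> = Min {1, \<delta> / B, (\<tau> - \<beta>) / (4 * (norm (G X) + 1))} / 2"
  have NG: "0 < norm (G X) + 1"
    by (simp add: add_nonneg_pos)
  have "0 < \<rho>"
    using \<delta> B NG \<open>\<beta> < \<tau>\<close> by (simp add: \<rho>_def)
  have "2 * \<rho> \<le> 1" "2 * \<rho> \<le> \<delta> / B" "2 * \<rho> \<le> (\<tau> - \<beta>) / (4 * (norm (G X) + 1))"
    by (simp_all add: \<rho>_def)
  then have \<rho>: "2 * \<rho> \<le> 1" "B * (2 * \<rho>) \<le> \<delta>" "2 * \<rho> * (4 * (norm (G X) + 1)) \<le> \<tau> - \<beta>"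
    using B NG by (simp_all add: pos_le_divide_eq mult.commute)
  have gradient: "norm (2 *\<^sub>R (G (R ** transpose R) ** R)) \<le> \<tau>" if R: "infdist R S < 2 * \<rho>" for R
  proof -
    define d where "d = infdist R S"
    obtain T where T: "T \<in> factors X" "d = norm (R - T)"
      using nearest_factor[of X R] S by (metis d_def)
    have d: "0 \<le> d" "d < 2 * \<rho>" "d \<le> 1"
      using R \<rho> infdist_nonneg[of R S] by (auto simp: d_def)
    have "norm T = norm T0"
      using norm_factors_eq T(1) T0 S(1) by blast
    moreover have "norm R \<le> norm T + norm (R - T)"
      using norm_triangle_ineq[of T "R - T"] by simp
    ultimately have normR: "norm R \<le> B"
      using T(2) d(3) B(2) by linarith
    let ?Y = "R ** transpose R"
    have "norm (?Y - X) \<le> B * d"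
      using gram_dist_le[of T0 X R] T0 S d by (simp add: B_def d_def)
    also have "\<dots> < B * (2 * \<rho>)"
      using d B by (intro mult_strict_left_mono) auto
    finally have "norm (?Y - X) < \<delta>"
      using \<rho> by simp
    then have GY: "norm (G ?Y - G X) \<le> e"
      using \<delta>(2)[OF gram_in_sym_mats] less_imp_le by blast
    let ?a = "2 *\<^sub>R (G X ** T)" and ?b = "2 *\<^sub>R (G X ** (R - T))"
      and ?c = "2 *\<^sub>R ((G ?Y - G X) ** R)"
    have "G ?Y ** R = G X ** T + (G X ** (R - T) + (G ?Y - G X) ** R)"
      by (simp add: matmul.diff_left matmul.diff_right)
    then have eq: "2 *\<^sub>R (G ?Y ** R) = ?a + (?b + ?c)"
      by (simp only: scaleR_add_right)
    have "norm (2 *\<^sub>R (G ?Y ** R)) \<le> norm ?a + (norm ?b + norm ?c)"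
      unfolding eq by (meson add_left_mono norm_triangle_ineq order_trans)
    also have "norm (2 *\<^sub>R (G X ** T)) \<le> \<beta>"
      using bound T S by blast
    also have "norm (2 *\<^sub>R (G X ** (R - T))) \<le> (\<tau> - \<beta>) / 2"
    proof -
      have "norm (G X ** (R - T)) \<le> norm (G X) * d"
        using norm_matrix_mul_le[of "G X" "R - T"] T by simp
      also have "\<dots> \<le> (norm (G X) + 1) * (2 * \<rho>)"
        using d NG by (intro mult_mono) auto
      finally have "norm (G X ** (R - T)) \<le> (norm (G X) + 1) * (2 * \<rho>)" .
      moreover have "norm ?b = 2 * norm (G X ** (R - T))"
        by simp
      ultimately have "norm ?b \<le> 2 * ((norm (G X) + 1) * (2 * \<rho>))"
        by linarith
      also have "\<dots> = 2 * \<rho> * (4 * (norm (G X) + 1)) / 2"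
        by simp
      also have "\<dots> \<le> (\<tau> - \<beta>) / 2"
        using \<rho>(3) by (rule divide_right_mono) simp
      finally show ?thesis .
    qed
    also have "norm (2 *\<^sub>R ((G ?Y - G X) ** R)) \<le> (\<tau> - \<beta>) / 2"
    proof -
      have "norm ((G ?Y - G X) ** R) \<le> norm (G ?Y - G X) * norm R"
        by (rule norm_matrix_mul_le)
      also have "\<dots> \<le> e * B"
        using GY normR e by (intro mult_mono) auto
      also have "\<dots> = (\<tau> - \<beta>) / 4"
        using B by (simp add: e_def)
      finally show ?thesis
        by simp
    qed
    finally show ?thesis
      by (simp add: field_simps)
  qed
  have local: "\<bar>phi_f f U - phi_f f W\<bar> \<le> \<tau> * norm (U - W)"
    if W: "infdist W S < \<rho>" and U: "norm (U - W) < \<rho>" for U W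
  proof -
    have tube: "infdist V S < 2 * \<rho>" if "V \<in> ball W \<rho>" for V
      using infdist_triangle[of V S W] W that by (simp add: dist_commute)
    have "norm (phi_f f U - phi_f f W) \<le> \<tau> * norm (U - W)"
    proof (rule differentiable_bound[OF convex_ball])
      fix V assume V: "V \<in> ball W \<rho>"
      let ?g = "2 *\<^sub>R (G (V ** transpose V) ** V)"
      show "(phi_f f has_derivative (\<lambda>H. ?g \<bullet> H)) (at V within ball W \<rho>)"
        by (rule has_derivative_at_withinI[OF phi_f_has_derivative[OF G[OF gram_in_sym_mats]]])
      show "onorm (\<lambda>H. ?g \<bullet> H) \<le> \<tau>"
      proof (rule onorm_le)
        fix H
        have "norm (?g \<bullet> H) \<le> norm ?g * norm H"
          unfolding real_norm_def by (rule Cauchy_Schwarz_ineq2)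
        also have "\<dots> \<le> \<tau> * norm H"
          using gradient[OF tube[OF V]] by (rule mult_right_mono) simp
        finally show "norm (?g \<bullet> H) \<le> \<tau> * norm H" .
      qed
    qed (use U \<open>0 < \<rho>\<close> in \<open>auto simp: dist_norm norm_minus_commute\<close>)
    then show ?thesis
      by simp
  qed
  show ?thesis
  proof (intro exI[of _ "\<rho> / 2"] conjI allI impI)
    fix \<epsilon> :: real assume \<epsilon>: "0 < \<epsilon>" "\<epsilon> < \<rho> / 2"
    show "\<tau>-lipschitz_on (nbhd S \<epsilon>) (phi_f f)"
    proof (rule lipschitz_onI)
      fix U W assume UW: "U \<in> nbhd S \<epsilon>" "W \<in> nbhd S \<epsilon>"
      have near_value: "\<bar>phi_f f V - f X\<bar> \<le> \<tau> * \<epsilon>" if V: "V \<in> nbhd S \<epsilon>" for V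
      proof -
        obtain T where T: "T \<in> factors X" "infdist V S = norm (V - T)"
          using nearest_factor[of X V] S by auto
        have "infdist T S = 0"
          using T S by simp
        then have "\<bar>phi_f f V - phi_f f T\<bar> \<le> \<tau> * norm (V - T)"
          using V \<epsilon> T \<open>0 < \<rho>\<close> by (intro local) (auto simp: nbhd_def)
        also have "\<dots> \<le> \<tau> * \<epsilon>"
          using V T \<tau> by (auto simp: nbhd_def)
        finally show ?thesis
          using T by (simp add: phi_f_def factors_def)
      qed
      have "\<bar>phi_f f U - phi_f f W\<bar> \<le> \<tau> * norm (U - W)"
      proof (cases "norm (U - W) < \<rho>")
        case True
        then show ?thesis
          using UW \<epsilon> by (intro local) (auto simp: nbhd_def)
      next
        case False
        have "\<bar>phi_f f U - phi_f f W\<bar> \<le> \<tau> * (2 * \<epsilon>)"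
          using near_value[OF UW(1)] near_value[OF UW(2)] by simp
        also have "\<dots> \<le> \<tau> * norm (U - W)"
          using False \<epsilon> \<tau> by (intro mult_left_mono) auto
        finally show ?thesis .
      qed
      then show "dist (phi_f f U) (phi_f f W) \<le> \<tau> * dist U W"
        by (simp add: dist_norm)
    qed (use \<tau> in simp)
  qed (use \<open>0 < \<rho>\<close> in simp)
qed

lemma best_lipschitz_le:
  assumes "L-lipschitz_on N g"
  shows "best_lipschitz N g \<le> L"
  unfolding best_lipschitz_def using assms
  by (intro cInf_lower bdd_belowI[of _ 0]) (auto dest: lipschitz_on_nonneg)

lemma constraint_qualification_lower_bound:
  fixes A :: "'k::finite \<Rightarrow> real^'n^'n"
  assumes "constraint_qualification A b S \<gamma>"
  obtains \<delta> where "0 < \<delta>" "\<And>R z. R \<in> nbhd S \<delta> \<Longrightarrow> \<gamma> * norm z \<le> norm (M_mat A R *v z)"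
proof -
  from assms have "0 < \<gamma>" and "\<exists>\<delta>>0. \<forall>R\<in>nbhd S \<delta>. \<gamma> \<le> nth_largest_sv CARD('k) (M_mat A R)"
    by (simp_all add: constraint_qualification_def)
  then obtain \<delta> where \<delta>: "0 < \<delta>" "\<forall>R\<in>nbhd S \<delta>. \<gamma> \<le> nth_largest_sv CARD('k) (M_mat A R)"
    by blast
  show thesis
  proof (rule that[OF \<delta>(1)])
    fix R z assume "R \<in> nbhd S \<delta>"
    with \<delta>(2) \<open>0 < \<gamma>\<close> show "\<gamma> * norm z \<le> norm (M_mat A R *v z)"
      by (intro norm_ge_smallest_singular_value) auto
  qed
qed

lemma threshold_eq:
  fixes S :: "(real^'r^'n) set" and A :: "'k::finite \<Rightarrow> real^'n^'n"
  assumes S: "S = factors X" "S \<noteq> {}"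
    and dual: "dual_optimum f A X y Z" and G: "has_sym_gradient f G X"
    and cq: "constraint_qualification A b S \<gamma>"
  shows "threshold f A S \<gamma> L = max (2 * L / \<gamma>) (2 * norm y)"
proof -
  obtain \<delta> where \<delta>: "0 < \<delta>" "\<And>R z. R \<in> nbhd S \<delta> \<Longrightarrow> \<gamma> * norm z \<le> norm (M_mat A R *v z)"
    using constraint_qualification_lower_bound[OF cq] by blast
  have "0 < \<gamma>"
    using cq by (simp add: constraint_qualification_def)
  then have "multiplier f A R = y" if "R \<in> S" for R
    using that S \<delta>(2)[of R] factors_subset_nbhd[OF \<delta>(1), of S]
    by (intro multiplier_eq_dual[OF dual G]) auto
  then have "(SUP R\<in>S. norm (multiplier f A R)) = norm y"
    using S(2) by simp
  then show ?thesis
    by (simp add: threshold_def)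
qed

text \<open>At a factor \<open>T\<close> of \<open>X\<close> the gradient of \<open>phi_f f\<close> is \<open>- 2 M y\<close> with \<open>M = M_mat A T\<close>, of norm
  at most \<open>2 \<parallel>y\<parallel> \<sigma>\<close>. Hence on small tubes the Lipschitz constant is at most slightly larger. The
  excess is absorbed by the right-hand side if that is positive; otherwise \<open>f\<close> is constant near
  \<open>X\<close>.\<close>

lemma best_lipschitz_small_tube:
  fixes S :: "(real^'r^'n) set" and A :: "'k::finite \<Rightarrow> real^'n^'n" and Rs :: "real^'r^'n"
  assumes S: "S = factors X" and Rs: "Rs \<in> S"
    and G: "\<And>Y. Y \<in> sym_mats \<Longrightarrow> has_sym_gradient f (G Y) Y"
    and cont: "continuous (at X within sym_mats) G"
    and dual: "dual_optimum f A X y Z"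
    and lip: "L-lipschitz_on (ball X \<delta>0 \<inter> sym_mats) f" "0 < \<delta>0"
    and "0 < \<gamma>" "0 \<le> a"
  defines "\<sigma> \<equiv> nth_largest_sv 1 (M_mat A Rs)"
  assumes \<sigma>: "0 < \<sigma>"
  shows "\<exists>\<epsilon>\<^sub>0>0. \<forall>\<epsilon>. 0 < \<epsilon> \<longrightarrow> \<epsilon> < \<epsilon>\<^sub>0 \<longrightarrow>
      a * (2 * best_lipschitz (nbhd S \<epsilon>) (phi_f f) / \<gamma>) \<le> 6 * (L + a * norm y * \<sigma> / \<gamma>)"
proof -
  define K where "K = L + a * norm y * \<sigma> / \<gamma>"
  have L: "0 \<le> L"
    using lip lipschitz_on_nonneg by blast
  have ay: "0 \<le> a * norm y * \<sigma> / \<gamma>"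
    using \<sigma> \<open>0 < \<gamma>\<close> \<open>0 \<le> a\<close> by simp
  have K: "0 \<le> K"
    using L ay by (simp add: K_def)
  have X: "X \<in> sym_mats"
    using Rs S gram_in_sym_mats[of Rs] by (simp add: factors_def)
  consider "0 < K" | "K = 0"
    using K by linarith
  then show ?thesis
  proof cases
    case 1
    \<comment> \<open>The excess over \<open>2 \<parallel>y\<parallel> \<sigma>\<close> contributes at most \<open>2 K\<close> after multiplication by \<open>2 a / \<gamma>\<close>.\<close>
    define \<tau> where "\<tau> = 2 * norm y * \<sigma> + \<gamma> * K / (a + 1)"
    have "norm (2 *\<^sub>R (G X ** T)) \<le> 2 * norm y * \<sigma>" if T: "T \<in> S" for T
    proof -
      have "norm (G X ** T) = norm (M_mat A T *v y)"
        using dual_optimum_gradient_mul_factor[OF dual G[OF X], of T] T S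
        by (simp add: norm_M_mat_mult_vec)
      also have "\<dots> = norm (M_mat A Rs *v y)"
        using norm_M_mat_factors_eq T Rs S by blast
      also have "\<dots> \<le> \<sigma> * norm y"
        unfolding \<sigma>_def by (rule norm_le_largest_singular_value)
      finally show ?thesis
        by (simp add: mult_ac)
    qed
    moreover have "2 * norm y * \<sigma> < \<tau>"
      using 1 \<open>0 < \<gamma>\<close> \<open>0 \<le> a\<close> by (simp add: \<tau>_def)
    ultimately obtain \<epsilon>\<^sub>0 where \<epsilon>\<^sub>0: "0 < \<epsilon>\<^sub>0"
        "\<And>\<epsilon>. 0 < \<epsilon> \<Longrightarrow> \<epsilon> < \<epsilon>\<^sub>0 \<Longrightarrow> \<tau>-lipschitz_on (nbhd S \<epsilon>) (phi_f f)"
      using phi_f_lipschitz_on_tube[OF S _ G cont, of "2 * norm y * \<sigma>" \<tau>] Rs by blast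
    have "a * (2 * best_lipschitz (nbhd S \<epsilon>) (phi_f f) / \<gamma>) \<le> 6 * K" if "0 < \<epsilon>" "\<epsilon> < \<epsilon>\<^sub>0" for \<epsilon>
    proof -
      have "a * (2 * best_lipschitz (nbhd S \<epsilon>) (phi_f f) / \<gamma>) \<le> a * (2 * \<tau> / \<gamma>)"
        using best_lipschitz_le[OF \<epsilon>\<^sub>0(2)[OF that]] \<open>0 < \<gamma>\<close> \<open>0 \<le> a\<close>
        by (intro mult_left_mono divide_right_mono) auto
      also have "\<dots> = 4 * (a * norm y * \<sigma> / \<gamma>) + 2 * (a / (a + 1)) * K"
        using \<open>0 < \<gamma>\<close> \<open>0 \<le> a\<close> by (simp add: \<tau>_def field_simps)
      also have "2 * (a / (a + 1)) * K \<le> 2 * 1 * K"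
        using \<open>0 \<le> a\<close> K by (intro mult_right_mono mult_left_mono) auto
      also have "4 * (a * norm y * \<sigma> / \<gamma>) \<le> 4 * K"
        using L by (simp add: K_def)
      finally show ?thesis
        by simp
    qed
    with \<epsilon>\<^sub>0(1) show ?thesis
      by (auto simp: K_def)
  next
    case 2
    have "L = 0"
      using 2 L ay by (simp add: K_def)
    define B where "B = 2 * norm Rs + 1"
    have B: "1 \<le> B"
      by (simp add: B_def)
    have "0-lipschitz_on (nbhd S \<epsilon>) (phi_f f)" if \<epsilon>: "0 < \<epsilon>" "\<epsilon> < min 1 (\<delta>0 / B)" for \<epsilon>
    proof (rule lipschitz_onI)
      have const: "phi_f f U = f X" if U: "U \<in> nbhd S \<epsilon>" for U
      proof -
        have "norm (U ** transpose U - X) \<le> B * infdist U S"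
          using gram_dist_le[of Rs X U] Rs S U \<epsilon> by (simp add: B_def nbhd_def)
        also have "\<dots> < B * (\<delta>0 / B)"
          using U \<epsilon> B by (intro mult_strict_left_mono) (auto simp: nbhd_def)
        finally have "U ** transpose U \<in> ball X \<delta>0 \<inter> sym_mats"
          using B by (simp add: gram_in_sym_mats dist_norm norm_minus_commute)
        then show ?thesis
          using lipschitz_onD[OF lip(1), of "U ** transpose U" X] X lip(2) \<open>L = 0\<close>
          by (simp add: phi_f_def)
      qed
      fix U W assume "U \<in> nbhd S \<epsilon>" "W \<in> nbhd S \<epsilon>"
      then show "dist (phi_f f U) (phi_f f W) \<le> 0 * dist U W"
        using const by simp
    qed simp
    then have le: "best_lipschitz (nbhd S \<epsilon>) (phi_f f) \<le> 0" if "0 < \<epsilon>" "\<epsilon> < min 1 (\<delta>0 / B)" for \<epsilon>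
      using best_lipschitz_le that by blast
    have "a * (2 * best_lipschitz (nbhd S \<epsilon>) (phi_f f) / \<gamma>) \<le> 6 * K" if "0 < \<epsilon>" "\<epsilon> < min 1 (\<delta>0 / B)" for \<epsilon>
      using le[OF that] \<open>0 < \<gamma>\<close> \<open>0 \<le> a\<close> K
      by (simp add: mult_nonneg_nonpos divide_nonpos_pos order_trans[of _ 0])
    moreover have "0 < min 1 (\<delta>0 / B)"
      using B lip(2) by simp
    ultimately show ?thesis
      unfolding K_def by blast
  qed
qed


section \<open>The convergence theorem\<close>

lemma setting_gradient:
  fixes S :: "(real^'r^'n) set" and A :: "'k::finite \<Rightarrow> real^'n^'n" and Q1 :: "real^'q^'n"
  assumes "setting_E f A b X S \<gamma> y Z \<or> setting_O f A b X S \<gamma> y Z Q1" "X \<in> sym_mats"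
  obtains G where "\<And>Y. Y \<in> sym_mats \<Longrightarrow> has_sym_gradient f (G Y) Y"
    "continuous (at X within sym_mats) G"
  using assms(1)
proof
  assume "setting_E f A b X S \<gamma> y Z"
  then obtain G H where GH: "C2_with f G H"
    by (auto simp: setting_E_def)
  then have "(G has_derivative H X) (at X within sym_mats)"
    using assms(2) by (simp add: C2_with_def)
  then have "continuous (at X within sym_mats) G"
    by (rule has_derivative_continuous)
  with GH show thesis
    using that[of G] by (auto simp: C2_with_def)
next
  assume "setting_O f A b X S \<gamma> y Z Q1"
  then obtain C where C: "C \<in> sym_mats" "\<And>X. X \<in> sym_mats \<Longrightarrow> f X = C \<bullet> X"
    by (auto simp: setting_O_def)
  have "has_sym_gradient f C Y" if "Y \<in> sym_mats" for Y
    unfolding has_sym_gradient_def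
  proof
    have "((\<lambda>Y. C \<bullet> Y) has_derivative (\<lambda>H. C \<bullet> H)) (at Y within sym_mats)"
      by (auto intro!: derivative_eq_intros)
    from has_derivative_transform[OF that C(2) this]
    show "(f has_derivative (\<lambda>H. C \<bullet> H)) (at Y within sym_mats)" .
  qed (rule C(1))
  then show thesis
    using that[of "\<lambda>_. C"] by simp
qed

text \<open>The rate of \<open>prox_linear_linear_rate\<close> may be relaxed to any larger factor \<open>q\<close>, because all gaps along
  the iteration are nonnegative.\<close>

lemma penalty_prox_linear_converges:
  fixes S :: "(real^'r^'n) set" and A :: "'k::finite \<Rightarrow> real^'n^'n"
  assumes A: "\<And>i. A i \<in> sym_mats" and f: "convex_on sym_mats f"
    and feas: "meas_op A X = b" and S: "S = factors X" "S \<noteq> {}"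
    and lip: "L-lipschitz_on (ball X \<delta>0 \<inter> sym_mats) f" "0 < \<delta>0"
    and dual: "dual_optimum f A X y Z" and cq: "constraint_qualification A b S \<gamma>"
    and lam: "0 \<le> lam"
    and growth: "quadratic_growth (phi f A b lam) (f X) S \<alpha>" "0 < \<alpha>"
    and q: "1 - 1 / (4 + 64 * (L + lam * onorm_on sym_mats (meas_op A)) / \<alpha>) \<le> q"
  shows "prox_linear_converges f A b lam L (f X) S q"
proof -
  define h where "h = h_fun f A b lam"
  define \<eta> where "\<eta> = L + lam * onorm_on sym_mats (meas_op A)"
  have hX: "h X = f X"
    by (simp add: h_def h_fun_def feas)
  have phi: "phi f A b lam = (\<lambda>R :: real^'r^'n. h (R ** transpose R))"
    by (simp add: fun_eq_iff phi_def h_def)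
  obtain \<delta>\<gamma> where \<delta>\<gamma>: "0 < \<delta>\<gamma>" "\<And>R z. R \<in> nbhd S \<delta>\<gamma> \<Longrightarrow> \<gamma> * norm z \<le> norm (M_mat A R *v z)"
    using constraint_qualification_lower_bound[OF cq] by blast
  have "0 < \<gamma>"
    using cq by (simp add: constraint_qualification_def)
  note direction = second_order_feasible_direction[OF A S feas dual this \<delta>\<gamma>, where lam = lam,
      folded h_def hX]
  have "\<eta>-lipschitz_on (ball X \<delta>0 \<inter> sym_mats) h"
    unfolding \<eta>_def h_def by (rule h_fun_lipschitz[OF lip(1) _ lam]) simp
  moreover have "convex_on sym_mats h"
    unfolding h_def by (rule convex_on_h_fun[OF f lam])
  ultimately obtain \<delta> where \<delta>: "0 < \<delta>"
    and rate: "\<And>R0 j. R0 \<in> nbhd S \<delta> \<Longrightarrow>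
      f X \<le> phi f A b lam (prox_linear h (1 / (2 * \<eta>)) R0 j) \<and>
      phi f A b lam (prox_linear h (1 / (2 * \<eta>)) R0 (Suc j)) - f X
        \<le> (1 - 1 / (4 + 64 * \<eta> / \<alpha>)) * (phi f A b lam (prox_linear h (1 / (2 * \<eta>)) R0 j) - f X)"
    using prox_linear_linear_rate[OF S _ _ lip(2) growth[unfolded phi, folded hX] direction, of \<eta>]
    unfolding phi hX by blast
  have "phi f A b lam (prox_linear h (1 / (2 * \<eta>)) R0 (Suc j)) - f X
      \<le> q * (phi f A b lam (prox_linear h (1 / (2 * \<eta>)) R0 j) - f X)" if "R0 \<in> nbhd S \<delta>" for R0 j
    using rate[OF that, of j] mult_right_mono[OF q[folded \<eta>_def],
        of "phi f A b lam (prox_linear h (1 / (2 * \<eta>)) R0 j) - f X"]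
    by simp
  with \<delta> show ?thesis
    unfolding prox_linear_converges_def Let_def \<eta>_def h_def by blast
qed

theorem theorem5:
  fixes f :: "real^'n^'n \<Rightarrow> real"
    and A :: "'k::finite \<Rightarrow> real^'n^'n"
    and b y :: "real^'k"
    and Xs Z :: "real^'n^'n"
    and S :: "(real^'r^'n) set"
    and Q1 :: "real^'q^'n"
    and \<gamma> L\<^sub>f :: real
  assumes "\<And>i. A i \<in> sym_mats"
    and "convex_on sym_mats f"
    and "{X. is_arg_min f (sdp_feasible A b) X} = {Xs}"
    and "S = factors Xs"
    and "\<exists>\<delta>>0. L\<^sub>f-lipschitz_on (ball Xs \<delta> \<inter> sym_mats) f"
    and "setting_E f A b Xs S \<gamma> y Z \<or> setting_O f A b Xs S \<gamma> y Z Q1"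
  shows "(\<forall>L lam \<alpha>.
            (\<exists>\<delta>>0. L-lipschitz_on (nbhd S \<delta>) (phi_f f)) \<longrightarrow>
            lam \<ge> threshold f A S \<gamma> L \<longrightarrow>
            \<alpha> > 0 \<longrightarrow> quadratic_growth (phi f A b lam) (f Xs) S \<alpha> \<longrightarrow>
            prox_linear_converges f A b lam L\<^sub>f (f Xs) S
              (1 - 1 / (209 + 5000 * (L\<^sub>f + lam * onorm_on sym_mats (meas_op A)) / \<alpha>))) \<and>
         (\<forall>Rs\<in>S. \<exists>\<epsilon>\<^sub>0>0. \<forall>\<epsilon> lam \<alpha>.
            0 < \<epsilon> \<longrightarrow> \<epsilon> < \<epsilon>\<^sub>0 \<longrightarrow>
            lam = threshold f A S \<gamma> (best_lipschitz (nbhd S \<epsilon>) (phi_f f)) \<longrightarrow>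
            \<alpha> > 0 \<longrightarrow> quadratic_growth (phi f A b lam) (f Xs) S \<alpha> \<longrightarrow>
            (\<exists>M\<ge>1.
               M \<le> 209 + 20000 * ((L\<^sub>f + onorm_on sym_mats (meas_op A) * norm y *
                                        nth_largest_sv 1 (M_mat A Rs) / \<gamma>) / \<alpha>) \<and>
               prox_linear_converges f A b lam L\<^sub>f (f Xs) S (1 - 1 / M)))"
proof -
  define a where "a = onorm_on sym_mats (meas_op A)"
  have a: "0 \<le> a"
    by (simp add: a_def onorm_meas_op_nonneg)
  obtain \<delta>0 where lip: "L\<^sub>f-lipschitz_on (ball Xs \<delta>0 \<inter> sym_mats) f" "0 < \<delta>0"
    using assms(5) by blast
  have Lf: "0 \<le> L\<^sub>f"
    using lip lipschitz_on_nonneg by blast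
  have "sdp_feasible A b Xs"
    using assms(3) by (auto simp: is_arg_min_def)
  then have feas: "meas_op A Xs = b" "psd Xs"
    by (auto simp: sdp_feasible_def)
  then have Xs: "Xs \<in> sym_mats"
    by (simp add: psd_def)
  have dual: "dual_optimum f A Xs y Z" and cq: "constraint_qualification A b S \<gamma>"
    and "rank Xs \<le> CARD('r)"
    using assms(6) by (auto simp: setting_E_def setting_O_def)
  then have S: "S \<noteq> {}"
    using factors_nonempty[OF feas(2)] assms(4) by blast
  obtain G where G: "\<And>Y. Y \<in> sym_mats \<Longrightarrow> has_sym_gradient f (G Y) Y"
      "continuous (at Xs within sym_mats) G"
    using setting_gradient[OF assms(6) Xs] by blast
  note threshold = threshold_eq[OF assms(4) S dual G(1)[OF Xs] cq]
  have \<gamma>: "0 < \<gamma>"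
    using cq by (simp add: constraint_qualification_def)
  have converges: "prox_linear_converges f A b lam L\<^sub>f (f Xs) S (1 - 1 / M)"
    if "threshold f A S \<gamma> L \<le> lam" "0 < \<alpha>" "quadratic_growth (phi f A b lam) (f Xs) S \<alpha>"
      "4 + 64 * (L\<^sub>f + lam * a) / \<alpha> \<le> M" for L lam \<alpha> M
  proof -
    have lam: "0 \<le> lam"
      using that(1) by (simp add: threshold) (meson norm_ge_zero order_trans zero_le_mult_iff zero_le_numeral)
    have "0 < 4 + 64 * (L\<^sub>f + lam * a) / \<alpha>"
      using Lf a lam that(2) by (simp add: add_pos_nonneg)
    then have "1 - 1 / (4 + 64 * (L\<^sub>f + lam * a) / \<alpha>) \<le> 1 - 1 / M"
      using that(4) by (simp add: frac_le)
    with that lam show ?thesis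
      unfolding a_def
      by (intro penalty_prox_linear_converges[OF assms(1,2) feas(1) assms(4) S lip dual cq]) auto
  qed
  show ?thesis
  proof (intro conjI allI impI ballI)
    fix L lam \<alpha> :: real
    assume *: "threshold f A S \<gamma> L \<le> lam" "0 < \<alpha>" "quadratic_growth (phi f A b lam) (f Xs) S \<alpha>"
    have "0 \<le> lam"
      using *(1) by (simp add: threshold) (meson norm_ge_zero order_trans zero_le_mult_iff zero_le_numeral)
    then have "0 \<le> (L\<^sub>f + lam * a) / \<alpha>"
      using Lf a *(2) by simp
    moreover have "4 + 64 * x \<le> 209 + 5000 * x" if "0 \<le> x" for x :: real
      using that by simp
    ultimately have "4 + 64 * (L\<^sub>f + lam * a) / \<alpha> \<le> 209 + 5000 * (L\<^sub>f + lam * a) / \<alpha>"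
      unfolding times_divide_eq_right[symmetric] by blast
    then show "prox_linear_converges f A b lam L\<^sub>f (f Xs) S
        (1 - 1 / (209 + 5000 * (L\<^sub>f + lam * onorm_on sym_mats (meas_op A)) / \<alpha>))"
      unfolding a_def[symmetric] by (rule converges[OF *])
  next
    fix Rs assume Rs: "Rs \<in> S"
    define \<sigma> where "\<sigma> = nth_largest_sv 1 (M_mat A Rs)"
    define K where "K = L\<^sub>f + a * norm y * \<sigma> / \<gamma>"
    have \<sigma>: "\<gamma> \<le> \<sigma>"
    proof -
      obtain \<delta> where \<delta>: "0 < \<delta>" "\<And>R z. R \<in> nbhd S \<delta> \<Longrightarrow> \<gamma> * norm z \<le> norm (M_mat A R *v z)"
        using constraint_qualification_lower_bound[OF cq] by blast
      obtain z :: "real^'k" where z: "norm z = 1"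
        using vector_choose_size[of 1] by auto
      have "\<gamma> * norm z \<le> norm (M_mat A Rs *v z)"
        using \<delta>(2) factors_subset_nbhd[OF \<delta>(1)] Rs by blast
      also have "\<dots> \<le> \<sigma> * norm z"
        unfolding \<sigma>_def by (rule norm_le_largest_singular_value)
      finally show ?thesis
        by (simp add: z)
    qed
    with \<gamma> have "0 < \<sigma>" by simp
    from best_lipschitz_small_tube[OF assms(4) Rs G dual lip \<gamma> a this[unfolded \<sigma>_def]]
    obtain \<epsilon>\<^sub>0 where \<epsilon>\<^sub>0: "0 < \<epsilon>\<^sub>0" "\<And>\<epsilon>. 0 < \<epsilon> \<Longrightarrow> \<epsilon> < \<epsilon>\<^sub>0 \<Longrightarrow>
        a * (2 * best_lipschitz (nbhd S \<epsilon>) (phi_f f) / \<gamma>) \<le> 6 * K"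
      by (auto simp: K_def \<sigma>_def)
    have ay: "a * (2 * norm y) \<le> 6 * K"
    proof -
      have "1 \<le> \<sigma> / \<gamma>"
        using \<sigma> \<gamma> by simp
      then have "(a * norm y) * 1 \<le> (a * norm y) * (\<sigma> / \<gamma>)"
        using a by (intro mult_left_mono) auto
      moreover have "0 \<le> a * norm y"
        using a by simp
      ultimately show ?thesis
        using Lf by (simp add: K_def)
    qed
    show "\<exists>\<epsilon>\<^sub>0>0. \<forall>\<epsilon> lam \<alpha>.
        0 < \<epsilon> \<longrightarrow> \<epsilon> < \<epsilon>\<^sub>0 \<longrightarrow>
        lam = threshold f A S \<gamma> (best_lipschitz (nbhd S \<epsilon>) (phi_f f)) \<longrightarrow>
        \<alpha> > 0 \<longrightarrow> quadratic_growth (phi f A b lam) (f Xs) S \<alpha> \<longrightarrow>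
        (\<exists>M\<ge>1.
           M \<le> 209 + 20000 * ((L\<^sub>f + onorm_on sym_mats (meas_op A) * norm y *
                                    nth_largest_sv 1 (M_mat A Rs) / \<gamma>) / \<alpha>) \<and>
           prox_linear_converges f A b lam L\<^sub>f (f Xs) S (1 - 1 / M))"
    proof (rule exI[of _ \<epsilon>\<^sub>0], intro conjI allI impI)
      fix \<epsilon> lam \<alpha> :: real
      assume \<epsilon>: "0 < \<epsilon>" "\<epsilon> < \<epsilon>\<^sub>0"
        and lam: "lam = threshold f A S \<gamma> (best_lipschitz (nbhd S \<epsilon>) (phi_f f))"
        and \<alpha>: "0 < \<alpha>" "quadratic_growth (phi f A b lam) (f Xs) S \<alpha>"
      define M where "M = 4 + 64 * (L\<^sub>f + lam * a) / \<alpha>"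
      have "lam * a \<le> 6 * K"
        using \<epsilon>\<^sub>0(2)[OF \<epsilon>] ay unfolding lam threshold by (simp add: max_def mult.commute)
      moreover have "L\<^sub>f \<le> K"
        using a \<gamma> \<open>0 < \<sigma>\<close> by (simp add: K_def)
      ultimately have "L\<^sub>f + lam * a \<le> 7 * K" "0 \<le> K"
        using Lf by linarith+
      then have "64 * (L\<^sub>f + lam * a) \<le> 20000 * K"
        by (intro order_trans[OF mult_left_mono[of "L\<^sub>f + lam * a" "7 * K" 64]]) auto
      then have "M \<le> 209 + 20000 * (K / \<alpha>)"
        using \<alpha>(1) divide_right_mono[of "64 * (L\<^sub>f + lam * a)" "20000 * K" \<alpha>] by (simp add: M_def)
      moreover have "0 \<le> lam"
        unfolding lam threshold by (simp add: le_max_iff_disj)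
      then have "1 \<le> M"
        using Lf a \<alpha>(1) by (simp add: M_def add_increasing2)
      moreover have "prox_linear_converges f A b lam L\<^sub>f (f Xs) S (1 - 1 / M)"
        using \<alpha> by (intro converges) (auto simp: lam M_def)
      ultimately show "\<exists>M\<ge>1.
           M \<le> 209 + 20000 * ((L\<^sub>f + onorm_on sym_mats (meas_op A) * norm y *
                                    nth_largest_sv 1 (M_mat A Rs) / \<gamma>) / \<alpha>) \<and>
           prox_linear_converges f A b lam L\<^sub>f (f Xs) S (1 - 1 / M)"
        unfolding a_def[symmetric] \<sigma>_def[symmetric] K_def[symmetric] by blast
    qed (rule \<epsilon>\<^sub>0(1))
  qed
qed

end
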